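(* For every $1\leqslant p<\infty$, $$J(H^p)=\{f\in\ell^p(\mathbb Z):\ \operatorname{supp}\mathcal Ff\subseteq[0,\pi]\},$$ where $\mathcal F$ is the Fourier transform in the sense of (periodic) distributions.
   Context: Lattice points $(m,n)\in\mathbb Z^2$ are identified with $m+in\in\mathbb C$. Let $\mathbb Z^2_+=\{m+in: m,n\in\mathbb Z,\ n\geqslant 0\}$. A function $f:\mathbb Z^2_+\to\mathbb C$ is discrete holomorphic, written $f\in\operatorname{Hol}(\mathbb Z^2_+)$, if $f(z)+i f(z+1)-f(z+1+i)-i f(z+i)=0$ for every $z\in\mathbb Z^2_+$. For $1\leqslant p\leqslant\infty$, $H^p=H^p(\mathbb Z^2_+)=\{f\in\operatorname{Hol}(\mathbb Z^2_+): \|f\|_{H^p}:=\sup_{n\geqslant 0}\|f(\cdot+in)\|_{\ell^p(\mathbb Z)}<\infty\}$. The restriction operator is $J:H^p\to\ell^p(\mathbb Z)$, $Jf=(f(m))_{m\in\mathbb Z}$. The torus $\mathbb T=\mathbb R/2\pi\mathbb Z$ is identified with $[-\pi,\pi]$. For $\psi\in C^\infty(\mathbb T)$ put $(\mathcal F^{-1}\psi)(n)=\frac1{\sqrt{2\pi}}\int_{-\pi}^\pi\psi(t)e^{int}\,dt$. For a sequence $u:\mathbb Z\to\mathbb C$ of at most polynomial growth (in particular $u\in\ell^p(\mathbb Z)$), its distributional Fourier transform $\mathcal Fu$ is the distribution on $\mathbb T$ given by $\langle\mathcal Fu,\psi\rangle=\sum_{n\in\mathbb Z}u(n)\,(\mathcal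 F^{-1}\psi)(-n)$, $\psi\in C^\infty(\mathbb T)$; for $u\in\ell^2(\mathbb Z)$ it agrees with the function $\frac1{\sqrt{2\pi}}\sum_n u(n)e^{-int}$. The condition $\operatorname{supp}\mathcal Ff\subseteq[0,\pi]$ means $\langle\mathcal Ff,\psi\rangle=0$ for every test function $\psi$ supported in $(-\pi,0)$. *)

theory Defs
  imports "HOL-Analysis.Analysis"
begin

text \<open>The lattice point \<open>m + i n\<close> with \<open>n \<ge> 0\<close> is encoded as the pair of arguments
  \<open>m :: int\<close>, \<open>n :: nat\<close>, so that a function on the upper half-lattice is exactly a function
  \<open>int \<Rightarrow> nat \<Rightarrow> complex\<close>.\<close>

definition Hol :: "(int \<Rightarrow> nat \<Rightarrow> complex) set" where
  "Hol = {f. \<forall>m n. f m n + \<i> * f (m + 1) n - f (m + 1) (n + 1) - \<i> * f m (n + 1) = 0}"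

text \<open>For a finite exponent; the norm is extended-valued, infinite exactly when the series of
  \<open>p\<close>-th powers diverges.\<close>

definition lp_norm :: "real \<Rightarrow> (int \<Rightarrow> complex) \<Rightarrow> ennreal" where
  "lp_norm p u =
     (if (\<lambda>m. cmod (u m) powr p) summable_on UNIV
      then ennreal ((\<Sum>\<^sub>\<infinity>m. cmod (u m) powr p) powr (1 / p)) else \<infinity>)"

definition lp :: "real \<Rightarrow> (int \<Rightarrow> complex) set" where
  "lp p = {u. lp_norm p u < \<infinity>}"

definition Hp_norm :: "real \<Rightarrow> (int \<Rightarrow> nat \<Rightarrow> complex) \<Rightarrow> ennreal" where
  "Hp_norm p f = (SUP n. lp_norm p (\<lambda>m. f m n))"

definition Hp :: "real \<Rightarrow> (int \<Rightarrow> nat \<Rightarrow> complex) set" where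
  "Hp p = {f \<in> Hol. Hp_norm p f < \<infinity>}"

definition boundary_restriction :: "(int \<Rightarrow> nat \<Rightarrow> complex) \<Rightarrow> (int \<Rightarrow> complex)" where
  "boundary_restriction f = (\<lambda>m. f m 0)"

text \<open>Functions on the torus are \<open>2\<pi>\<close>-periodic functions on the real line; smoothness means that
  every iterated derivative is differentiable everywhere.\<close>

definition torus_test_functions :: "(real \<Rightarrow> complex) set" where
  "torus_test_functions =
     {\<psi>. (\<forall>t. \<psi> (t + 2 * pi) = \<psi> t) \<and>
         (\<forall>k t. ((\<lambda>g s. vector_derivative g (at s)) ^^ k) \<psi> differentiable (at t))}"

text \<open>The support on the torus, represented inside \<open>[-\<pi>, \<pi>]\<close>. The closure is taken for the periodic
  function on the whole line, so \<open>-\<pi>\<close> and \<open>\<pi>\<close> belong to it simultaneously.\<close>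

definition torus_support :: "(real \<Rightarrow> complex) \<Rightarrow> real set" where
  "torus_support \<psi> = closure {t. \<psi> t \<noteq> 0} \<inter> {-pi..pi}"

definition inverse_fourier :: "(real \<Rightarrow> complex) \<Rightarrow> int \<Rightarrow> complex" where
  "inverse_fourier \<psi> n =
     of_real (1 / sqrt (2 * pi)) *
     integral {-pi..pi} (\<lambda>t. \<psi> t * exp (\<i> * of_int n * of_real t))"

text \<open>\<open>fourier_pairing u \<psi>\<close> is the value of the distributional Fourier transform of \<open>u\<close> at the test
  function \<open>\<psi>\<close>. For \<open>u\<close> of polynomial growth the series converges absolutely, since the Fourier
  coefficients of a smooth function decay rapidly, so the default value of the infinite sum plays
  no role.\<close>

definition fourier_pairing :: "(int \<Rightarrow> complex) \<Rightarrow> (real \<Rightarrow> complex) \<Rightarrow> complex" where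
  "fourier_pairing u \<psi> = (\<Sum>\<^sub>\<infinity>n. u n * inverse_fourier \<psi> (-n))"

text \<open>For a distribution \<open>T\<close> on the torus: the support of \<open>T\<close> is contained in the closed arc
  \<open>[0, \<pi>]\<close>, i.e. \<open>T\<close> vanishes on the complementary open arc \<open>(-\<pi>, 0)\<close>.\<close>

definition supported_in_upper_arc :: "((real \<Rightarrow> complex) \<Rightarrow> complex) \<Rightarrow> bool" where
  "supported_in_upper_arc T \<longleftrightarrow>
     (\<forall>\<psi>\<in>torus_test_functions. torus_support \<psi> \<subseteq> {-pi<..<0} \<longrightarrow> T \<psi> = 0)"

end

theory Submission
  imports Defs "HOL-Real_Asymp.Real_Asymp"
begin

text \<open>The row equation of a discrete holomorphic function multiplies the mode \<open>e\<^sup>i\<^sup>m\<^sup>t\<close> by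
  \<open>(1 + i e\<^sup>i\<^sup>t) / (e\<^sup>i\<^sup>t + i) = cos t / (1 + sin t)\<close> when passing to the next row, and this real number
  has modulus at most \<open>1\<close> exactly when \<open>sin t \<ge> 0\<close>.

  Let \<open>\<psi>\<close> be a test function supported in \<open>(-\<pi>, 0)\<close> and \<open>\<mu> = cos t / (1 - sin t)\<close> the inverse multiplier.
  Pairing row \<open>0\<close> with \<open>\<psi>\<close> is the same as pairing row \<open>n\<close> with \<open>\<psi> \<mu>\<^sup>n\<close>; as \<open>\<bar>\<mu>\<bar> \<le> r < 1\<close> on the support,
  two integrations by parts show that the Fourier coefficients of \<open>\<psi> \<mu>\<^sup>n\<close> have \<open>\<ell>\<^sup>1\<close> norm \<open>O(n\<^sup>2 r\<^sup>n)\<close>, while the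
  rows stay bounded. Hence the pairing is \<open>0\<close>.

  Conversely, row \<open>n\<close> is defined as the convolution of \<open>u\<close> with the kernel whose symbol is
  \<open>\<nu>\<^sup>n\<close>, \<open>\<nu> = cos t / (1 + \<bar>sin t\<bar>)\<close>. Its coefficients are \<open>O(1/n)\<close> and \<open>O(n/k\<^sup>2)\<close>, so their \<open>\<ell>\<^sup>1\<close> norms are bounded
  uniformly in \<open>n\<close> and Young's inequality bounds the rows. The defect in the row equation is convolution of \<open>u\<close>
  with a symbol \<open>d\<close> vanishing on \<open>[0, \<pi>]\<close>. Multiplying \<open>d\<close> by \<open>sin\<^sup>2 t (1 - sin t)\<^sup>n\<^sup>+\<^sup>1\<close> gives a trigonometric
  polynomial times the cube of the positive part of \<open>- sin t\<close>. That cube is a limit of test functions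
  supported in \<open>(-\<pi>, 0)\<close> and so annihilates \<open>u\<close>; and since a nonzero sequence in \<open>\<ell>\<^sup>p\<close>, \<open>p < \<infinity>\<close>, is not annihilated by a
  difference operator \<open>S - a\<close> with \<open>\<bar>a\<bar> = 1\<close>, the factors \<open>sin\<^sup>2 t (1 - sin t)\<^sup>n\<^sup>+\<^sup>1\<close> can be cancelled.\<close>

section \<open>Fourier coefficients and convolution\<close>

text \<open>The factor \<open>1 / (2 * pi)\<close> is dropped and the sign of the exponent is that of
  \<^const>\<open>inverse_fourier\<close>; with this sign a horizontal shift of the sequence
  \<open>spectral_conv u g\<close> is multiplication of \<open>g\<close> by \<open>e\<^sup>i\<^sup>t\<close>.\<close>

definition fourier_coeff :: "(real \<Rightarrow> complex) \<Rightarrow> int \<Rightarrow> complex" where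
  "fourier_coeff g k = integral {-pi..pi} (\<lambda>t. g t * exp (\<i> * of_int k * of_real t))"

text \<open>The Wiener algebra of the circle. Summable coefficients make the convolution with any
  bounded sequence converge absolutely.\<close>

definition wiener :: "(real \<Rightarrow> complex) set" where
  "wiener = {g. continuous_on {-pi..pi} g \<and> (\<lambda>k. cmod (fourier_coeff g k)) summable_on UNIV}"

text \<open>For \<open>g\<close> in \<open>wiener\<close>, this is the Fourier multiplier with
  symbol \<open>2 * pi * g\<close>: it multiplies the mode \<open>e^(imt)\<close> by
  \<open>2 * pi * g t\<close>.\<close>

definition spectral_conv :: "(int \<Rightarrow> complex) \<Rightarrow> (real \<Rightarrow> complex) \<Rightarrow> int \<Rightarrow> complex" where
  "spectral_conv u g m = (\<Sum>\<^sub>\<infinity>k. u k * fourier_coeff g (m - k))"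

abbreviation eit :: "real \<Rightarrow> complex" where
  "eit t \<equiv> exp (\<i> * of_real t)"

lemma fourier_coeff_integrable:
  assumes "continuous_on {-pi..pi} g"
  shows "(\<lambda>t. g t * exp (\<i> * of_int k * of_real t)) integrable_on {-pi..pi}"
  by (intro integrable_continuous_real continuous_intros assms)

lemma fourier_coeff_add:
  assumes "continuous_on {-pi..pi} g" "continuous_on {-pi..pi} h"
  shows "fourier_coeff (\<lambda>t. g t + h t) k = fourier_coeff g k + fourier_coeff h k"
  unfolding fourier_coeff_def using assms
  by (simp add: distrib_right integral_add fourier_coeff_integrable)

lemma fourier_coeff_cmult: "fourier_coeff (\<lambda>t. c * g t) k = c * fourier_coeff g k"
  unfolding fourier_coeff_def by (simp add: mult.assoc)

lemma fourier_coeff_shift: "fourier_coeff (\<lambda>t. eit t * g t) k = fourier_coeff g (k + 1)"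
  unfolding fourier_coeff_def by (simp add: algebra_simps exp_add)

lemma fourier_coeff_bound:
  assumes "continuous_on {-pi..pi} g" and "\<And>t. t \<in> {-pi..pi} \<Longrightarrow> cmod (g t) \<le> B"
  shows "cmod (fourier_coeff g k) \<le> 2 * pi * B"
proof -
  have "cmod (fourier_coeff g k) \<le> B * (pi - (- pi))"
    unfolding fourier_coeff_def
    by (rule integral_bound) (use assms in \<open>auto intro!: continuous_intros simp: norm_mult\<close>)
  then show ?thesis by (simp add: algebra_simps)
qed

lemma fourier_coeff_cong:
  assumes "\<And>t. t \<in> {-pi..pi} \<Longrightarrow> g t = h t"
  shows "fourier_coeff g k = fourier_coeff h k"
  unfolding fourier_coeff_def by (rule integral_cong) (simp add: assms)

text \<open>The function \<open>F\<close> performs both integrations by parts at once: its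
  derivative is \<open>(k^2 g + g2) e^(ikt)\<close> and its end values agree by periodicity, so
  \<open>k^2\<close> times the coefficient of \<open>g\<close> is minus that of
  \<open>g2\<close>.\<close>

lemma fourier_coeff_second_derivative_bound:
  fixes g g1 g2 :: "real \<Rightarrow> complex"
  assumes d1: "\<And>t. t \<in> {-pi..pi} \<Longrightarrow> (g has_vector_derivative g1 t) (at t within {-pi..pi})"
    and d2: "\<And>t. t \<in> {-pi..pi} \<Longrightarrow> (g1 has_vector_derivative g2 t) (at t within {-pi..pi})"
    and ends: "g (-pi) = g pi" "g1 (-pi) = g1 pi"
    and B: "\<And>t. t \<in> {-pi..pi} \<Longrightarrow> cmod (g2 t) \<le> B"
  shows "cmod (fourier_coeff g k) * (real_of_int k)\<^sup>2 \<le> 2 * pi * B"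
proof (cases "k = 0")
  case True
  have "0 \<le> B" using B[of 0] norm_ge_zero[of "g2 0"] by (simp del: norm_ge_zero)
  then show ?thesis using True by simp
next
  case False
  let ?e = "\<lambda>t. exp (\<i> * of_int k * of_real t) :: complex"
  have de: "(?e has_vector_derivative (\<i> * of_int k * ?e t)) (at t within S)" for t S
    by (rule has_vector_derivative_real_field derivative_eq_intros refl | simp)+
  have ee: "?e (-pi) = ?e pi"
  proof -
    have "?e pi = ?e (-pi) * exp (of_int k * (of_real (2 * pi) * \<i>))"
      by (subst exp_add[symmetric]) (simp add: algebra_simps)
    also have "exp (of_int k * (of_real (2 * pi) * \<i>)) = 1"
      using exp_integer_2pi[of "of_int k"] by (simp add: algebra_simps)
    finally show ?thesis by simp
  qed
  define F where "F t = of_int k * (- \<i>) * (g t * ?e t) + g1 t * ?e t" for t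
  have "(F has_vector_derivative (((of_int k)\<^sup>2 * g t + g2 t) * ?e t)) (at t within {-pi..pi})"
    if "t \<in> {-pi..pi}" for t
  proof -
    have "(F has_vector_derivative
        of_int k * (- \<i>) * (g t * (\<i> * of_int k * ?e t) + g1 t * ?e t) +
        (g1 t * (\<i> * of_int k * ?e t) + g2 t * ?e t)) (at t within {-pi..pi})"
      unfolding F_def
      by (intro has_vector_derivative_add has_vector_derivative_mult_right
          has_vector_derivative_mult d1 d2 de that)
    then show ?thesis by (simp add: algebra_simps power2_eq_square)
  qed
  then have "((\<lambda>t. ((of_int k)\<^sup>2 * g t + g2 t) * ?e t) has_integral (F pi - F (-pi))) {-pi..pi}"
    by (intro fundamental_theorem_of_calculus) auto
  then have 1: "((\<lambda>t. ((of_int k)\<^sup>2 * g t + g2 t) * ?e t) has_integral 0) {-pi..pi}"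
    using ends ee by (simp add: F_def)
  have cg: "continuous_on {-pi..pi} g"
    using d1 by (meson continuous_on_eq_continuous_within has_vector_derivative_continuous)
  have 2: "((\<lambda>t. (of_int k)\<^sup>2 * (g t * ?e t)) has_integral ((of_int k)\<^sup>2 * fourier_coeff g k)) {-pi..pi}"
    unfolding fourier_coeff_def by (intro has_integral_mult_right integrable_integral fourier_coeff_integrable cg)
  have "((\<lambda>t. g2 t * ?e t) has_integral (0 - (of_int k)\<^sup>2 * fourier_coeff g k)) {-pi..pi}"
    using has_integral_diff[OF 1 2] by (simp add: algebra_simps)
  then have "norm (0 - (of_int k)\<^sup>2 * fourier_coeff g k) \<le> B * Sigma_Algebra.measure lborel (cbox (-pi) pi)"
    by (intro has_integral_bound[where f = "\<lambda>t. g2 t * ?e t"])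
       (use B in \<open>auto simp: norm_mult intro: order_trans[OF norm_ge_zero B[of 0]]\<close>)
  then show ?thesis by (simp add: norm_mult norm_power algebra_simps)
qed

section \<open>Absolute summability from decay\<close>

text \<open>The first bound is summed up to \<open>N\<close> and the second beyond \<open>N\<close>,
  where \<open>1 / k^2 \<le> 1 / (k - 1) - 1 / k\<close> telescopes.\<close>

lemma sum_decay_le:
  fixes b :: "nat \<Rightarrow> real" and N :: nat and C :: real
  assumes "N \<ge> 1" "C \<ge> 0" and b1: "\<And>k. b k \<le> C / N" and b2: "\<And>k. b k * (real k)\<^sup>2 \<le> C * N"
  shows "(\<Sum>k=1..M. b k) \<le> 2 * C"
proof -
  \<comment> \<open>The two branches bound the partial sums before and after \<open>N\<close>; they
    agree at \<open>M = N\<close>, which starts the telescoping tail.\<close>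
  have "(\<Sum>k=1..M. b k) \<le> C * (if M \<le> N then M / N else 2 - N / M)" for M
  proof (induction M)
    case 0
    then show ?case by simp
  next
    case (Suc M)
    show ?case
    proof (cases "Suc M \<le> N")
      case True
      have "C * (real (Suc M) / N) = C * (M / N) + C / N"
        by (simp add: distrib_left add_divide_distrib)
      then show ?thesis using Suc b1[of "Suc M"] True by simp
    next
      case False
      then have MN: "N \<le> M" by simp
      have "b (Suc M) \<le> C * N / (real (Suc M))\<^sup>2"
        using b2[of "Suc M"] by (simp add: field_simps)
      also have "\<dots> \<le> C * N / (real M * real (Suc M))"
        using MN assms by (intro divide_left_mono mult_nonneg_nonneg) (auto simp: power2_eq_square)
      also have "\<dots> = C * (N / M - N / Suc M)"
        using MN assms by (simp add: field_simps)
      finally have 1: "b (Suc M) \<le> C * (N / M - N / Suc M)" .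
      have "(if M \<le> N then real M / N else 2 - N / M) = 2 - N / M"
        using MN assms by auto
      with Suc have "(\<Sum>k=1..M. b k) \<le> C * (2 - N / M)" by simp
      then have "(\<Sum>k=1..Suc M. b k) \<le> C * (2 - N / Suc M)"
        using 1 by (simp add: right_diff_distrib)
      then show ?thesis using False by simp
    qed
  qed
  also have "C * (if M \<le> N then M / N else 2 - N / M) \<le> C * 2"
    using assms by (intro mult_left_mono) (auto simp: field_simps)
  finally show ?thesis by simp
qed

text \<open>The decay of the Poisson kernel \<open>n / (n\<^sup>2 + k\<^sup>2)\<close> at height \<open>N\<close>; the bound does not depend on \<open>N\<close>.\<close>

lemma decay_abs_summable:
  fixes a :: "int \<Rightarrow> complex"
  assumes N: "N \<ge> (1::nat)" and C: "C \<ge> 0" and b1: "\<And>k. cmod (a k) \<le> C / N"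
    and b2: "\<And>k. cmod (a k) * (real_of_int k)\<^sup>2 \<le> C * N"
  shows "(\<lambda>k. cmod (a k)) summable_on UNIV" "(\<Sum>\<^sub>\<infinity>k. cmod (a k)) \<le> 5 * C"
proof -
  have fin: "(\<Sum>k\<in>F. cmod (a k)) \<le> 5 * C" if "finite F" for F
  proof -
    obtain M :: nat where M: "F \<subseteq> {- int M..int M}"
    proof -
      obtain M where "\<forall>k\<in>F. nat \<bar>k\<bar> \<le> M"
        using finite_nat_set_iff_bounded_le[of "(\<lambda>k. nat \<bar>k\<bar>) ` F"] \<open>finite F\<close> by auto
      then show ?thesis by (intro that[of M]) force
    qed
    have e: "{- int M..int M} = insert 0 (int ` {1..M} \<union> (\<lambda>k. - int k) ` {1..M})"
    proof -
      have "k \<in> int ` {1..M} \<union> (\<lambda>k. - int k) ` {1..M}" if "k \<in> {- int M..int M}" "k \<noteq> 0" for k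
      proof (cases "k > 0")
        case True
        then have "k \<in> int ` {1..M}"
          using that by (intro image_eqI[of _ _ "nat k"]) auto
        then show ?thesis ..
      next
        case False
        then have "k \<in> (\<lambda>k. - int k) ` {1..M}"
          using that by (intro image_eqI[of _ _ "nat (- k)"]) auto
        then show ?thesis ..
      qed
      then have "{- int M..int M} \<subseteq> insert 0 (int ` {1..M} \<union> (\<lambda>k. - int k) ` {1..M})"
        by blast
      then show ?thesis by (rule equalityI) auto
    qed
    have "(\<Sum>k\<in>F. cmod (a k)) \<le> (\<Sum>k\<in>{- int M..int M}. cmod (a k))"
      by (rule sum_mono2) (use M in auto)
    also have "\<dots> = cmod (a 0) + ((\<Sum>k=1..M. cmod (a (int k))) + (\<Sum>k=1..M. cmod (a (- int k))))"
      unfolding e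
      by (subst sum.insert, (force+)[2], subst sum.union_disjoint, (force+)[3])
         (simp add: sum.reindex inj_on_def)
    \<comment> \<open>One \<open>C\<close> for \<open>k = 0\<close> and \<open>2 * C\<close> for
      each half-line give the constant \<open>5\<close>.\<close>
    also have "\<dots> \<le> C + (2 * C + 2 * C)"
    proof (intro add_mono sum_decay_le[OF N C])
      have "C / N \<le> C / 1" by (rule divide_left_mono) (use N C in auto)
      then show "cmod (a 0) \<le> C" using b1[of 0] by simp
    qed (use b1 b2[of "int _"] b2[of "- int _"] in auto)
    finally show ?thesis by simp
  qed
  show "(\<lambda>k. cmod (a k)) summable_on UNIV"
    by (rule nonneg_bdd_above_summable_on) (auto intro!: bdd_aboveI[of _ "5 * C"] fin)
  then show "(\<Sum>\<^sub>\<infinity>k. cmod (a k)) \<le> 5 * C"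
    by (rule infsum_le_finite_sums) (use fin in auto)
qed

section \<open>Reindexing sums over the integers\<close>

lemma has_sum_int_reflect: "((\<lambda>k::int. f (m - k)) has_sum s) UNIV \<longleftrightarrow> (f has_sum s) UNIV"
  by (rule has_sum_reindex_bij_witness[where i = "\<lambda>k. m - k" and j = "\<lambda>k. m - k"]) auto

lemma summable_int_reflect: "(\<lambda>k::int. f (m - k)) summable_on UNIV \<longleftrightarrow> f summable_on UNIV"
  unfolding summable_on_def by (simp add: has_sum_int_reflect)

lemma infsum_int_reflect: "(\<Sum>\<^sub>\<infinity>k::int. f (m - k)) = (\<Sum>\<^sub>\<infinity>k. f k)"
  by (rule infsum_reindex_bij_witness[where i = "\<lambda>k. m - k" and j = "\<lambda>k. m - k"]) auto

lemma has_sum_int_shift: "((\<lambda>k::int. f (k + m)) has_sum s) UNIV \<longleftrightarrow> (f has_sum s) UNIV"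
  by (rule has_sum_reindex_bij_witness[where i = "\<lambda>k. k - m" and j = "\<lambda>k. k + m"]) auto

lemma summable_int_shift: "(\<lambda>k::int. f (k + m)) summable_on UNIV \<longleftrightarrow> f summable_on UNIV"
  unfolding summable_on_def by (simp add: has_sum_int_shift)

lemma infsum_int_shift: "(\<Sum>\<^sub>\<infinity>k::int. f (k + m)) = (\<Sum>\<^sub>\<infinity>k. f k)"
  by (rule infsum_reindex_bij_witness[where i = "\<lambda>k. k - m" and j = "\<lambda>k. k + m"]) auto

section \<open>Convolution with symbols in the Wiener algebra\<close>

lemma wiener_cont: "g \<in> wiener \<Longrightarrow> continuous_on {-pi..pi} g"
  by (simp add: wiener_def)

lemma wiener_add:
  assumes "g \<in> wiener" "h \<in> wiener"
  shows "(\<lambda>t. g t + h t) \<in> wiener"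
proof -
  have "(\<lambda>k. cmod (fourier_coeff g k + fourier_coeff h k)) summable_on UNIV"
    by (rule summable_on_comparison_test[OF summable_on_add[of "\<lambda>k. cmod (fourier_coeff g k)" UNIV "\<lambda>k. cmod (fourier_coeff h k)"]])
       (use assms in \<open>auto simp: wiener_def norm_triangle_ineq\<close>)
  then show ?thesis
    using assms unfolding wiener_def by (auto intro!: continuous_intros simp: fourier_coeff_add)
qed

lemma wiener_cmult: "g \<in> wiener \<Longrightarrow> (\<lambda>t. c * g t) \<in> wiener"
  unfolding wiener_def
  by (auto intro!: continuous_intros summable_on_cmult_right simp: fourier_coeff_cmult norm_mult)

lemma wiener_shift:
  assumes "g \<in> wiener"
  shows "(\<lambda>t. eit t * g t) \<in> wiener"
  using assms summable_int_shift[of "\<lambda>k. cmod (fourier_coeff g k)" 1] unfolding wiener_def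
  by (auto intro!: continuous_intros simp: fourier_coeff_shift)

lemma spectral_conv_summable:
  assumes "g \<in> wiener" and "\<And>k. cmod (u k) \<le> B"
  shows "(\<lambda>k. cmod (u k * fourier_coeff g (m - k))) summable_on UNIV"
proof (rule summable_on_comparison_test)
  show "(\<lambda>k. B * cmod (fourier_coeff g (m - k))) summable_on UNIV"
    using assms summable_int_reflect[of "\<lambda>k. cmod (fourier_coeff g k)" m]
    by (auto intro!: summable_on_cmult_right simp: wiener_def)
qed (use assms in \<open>auto simp: norm_mult intro!: mult_right_mono\<close>)

lemma spectral_conv_bound:
  assumes "g \<in> wiener" and "\<And>k. cmod (u k) \<le> B"
  shows "cmod (spectral_conv u g m) \<le> B * (\<Sum>\<^sub>\<infinity>k. cmod (fourier_coeff g k))"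
proof -
  have s: "(\<lambda>k. cmod (fourier_coeff g (m - k))) summable_on UNIV"
    using assms summable_int_reflect[of "\<lambda>k. cmod (fourier_coeff g k)" m] by (auto simp: wiener_def)
  have "cmod (spectral_conv u g m) \<le> (\<Sum>\<^sub>\<infinity>k. cmod (u k * fourier_coeff g (m - k)))"
    unfolding spectral_conv_def by (rule norm_infsum_bound) (rule spectral_conv_summable[OF assms])
  also have "\<dots> \<le> (\<Sum>\<^sub>\<infinity>k. B * cmod (fourier_coeff g (m - k)))"
    by (rule infsum_mono[OF spectral_conv_summable[OF assms] summable_on_cmult_right[OF s]])
       (use assms in \<open>auto simp: norm_mult intro!: mult_right_mono\<close>)
  also have "\<dots> = B * (\<Sum>\<^sub>\<infinity>k. cmod (fourier_coeff g k))"
    by (simp add: infsum_cmult_right' infsum_int_reflect[of "\<lambda>k. cmod (fourier_coeff g k)"])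
  finally show ?thesis .
qed

lemma spectral_conv_add:
  assumes "g \<in> wiener" "h \<in> wiener" and "\<And>k. cmod (u k) \<le> B"
  shows "spectral_conv u (\<lambda>t. g t + h t) m = spectral_conv u g m + spectral_conv u h m"
  using spectral_conv_summable[OF assms(1,3), THEN abs_summable_summable]
    spectral_conv_summable[OF assms(2,3), THEN abs_summable_summable]
  by (simp add: spectral_conv_def fourier_coeff_add assms wiener_cont distrib_left infsum_add)

lemma spectral_conv_cmult: "spectral_conv u (\<lambda>t. c * g t) m = c * spectral_conv u g m"
  unfolding spectral_conv_def fourier_coeff_cmult by (simp add: mult.left_commute infsum_cmult_right')

lemma spectral_conv_shift: "spectral_conv u (\<lambda>t. eit t * g t) m = spectral_conv u g (m + 1)"
  unfolding spectral_conv_def fourier_coeff_shift by (simp add: algebra_simps)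

lemma spectral_conv_shift_left: "spectral_conv (\<lambda>k. u (k + 1)) g m = spectral_conv u g (m + 1)"
  unfolding spectral_conv_def using infsum_int_shift[of "\<lambda>k. u k * fourier_coeff g (m + 1 - k)" 1] by simp

lemma spectral_conv_cong:
  assumes "\<And>t. t \<in> {-pi..pi} \<Longrightarrow> g t = h t"
  shows "spectral_conv u g m = spectral_conv u h m"
  unfolding spectral_conv_def using fourier_coeff_cong[OF assms] by simp

lemma spectral_conv_add_left:
  assumes "g \<in> wiener" "\<And>k. cmod (u k) \<le> A" "\<And>k. cmod (v k) \<le> B"
  shows "spectral_conv (\<lambda>k. u k + v k) g m = spectral_conv u g m + spectral_conv v g m"
  using spectral_conv_summable[OF assms(1,2), THEN abs_summable_summable]
    spectral_conv_summable[OF assms(1,3), THEN abs_summable_summable]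
  by (simp add: spectral_conv_def distrib_right infsum_add)

lemma spectral_conv_cmult_left: "spectral_conv (\<lambda>k. c * u k) g m = c * spectral_conv u g m"
  unfolding spectral_conv_def by (simp add: mult.assoc infsum_cmult_right')

section \<open>Restrictions of Hardy functions have spectrum in the upper arc\<close>

lemma lp_norm_finite_iff: "lp_norm p u < \<infinity> \<longleftrightarrow> (\<lambda>m. cmod (u m) powr p) summable_on UNIV"
  by (simp add: lp_norm_def)

text \<open>A single term of the series of \<open>p\<close>-th powers is at most its sum.\<close>

lemma norm_le_of_lp_norm_le:
  assumes "1 \<le> p" "0 \<le> c" "lp_norm p u \<le> ennreal c"
  shows "cmod (u m) \<le> c"
proof -
  have s: "(\<lambda>m. cmod (u m) powr p) summable_on UNIV"
    using assms(3) by (auto simp: lp_norm_def top_unique split: if_splits)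
  then have "ennreal ((\<Sum>\<^sub>\<infinity>m. cmod (u m) powr p) powr (1 / p)) \<le> ennreal c"
    using assms(3) by (simp add: lp_norm_def)
  then have le: "(\<Sum>\<^sub>\<infinity>m. cmod (u m) powr p) powr (1 / p) \<le> c"
    using assms(2) by simp
  have "cmod (u m) powr p \<le> (\<Sum>\<^sub>\<infinity>m. cmod (u m) powr p)"
    using finite_sum_le_infsum[OF s, of "{m}"] by simp
  then have "(cmod (u m) powr p) powr (1 / p) \<le> (\<Sum>\<^sub>\<infinity>m. cmod (u m) powr p) powr (1 / p)"
    using assms(1) by (intro powr_mono2) auto
  then show ?thesis using le assms(1) by (simp add: powr_powr)
qed

lemma lp_bounded:
  assumes "1 \<le> p" "u \<in> lp p"
  obtains B where "\<And>m. cmod (u m) \<le> B"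
proof -
  have "lp_norm p u \<le> ennreal (enn2real (lp_norm p u))"
    using assms(2) by (simp add: lp_def)
  from norm_le_of_lp_norm_le[OF assms(1) enn2real_nonneg this] show ?thesis by (rule that)
qed

lemma Hp_bounded:
  assumes "1 \<le> p" "f \<in> Hp p"
  obtains B where "\<And>m n. cmod (f m n) \<le> B"
proof -
  let ?c = "enn2real (Hp_norm p f)"
  have "lp_norm p (\<lambda>m. f m n) \<le> ennreal ?c" for n
  proof -
    have "lp_norm p (\<lambda>m. f m n) \<le> Hp_norm p f"
      unfolding Hp_norm_def by (rule SUP_upper) simp
    also have "\<dots> = ennreal ?c" using assms(2) by (simp add: Hp_def)
    finally show ?thesis .
  qed
  from norm_le_of_lp_norm_le[OF assms(1) enn2real_nonneg this] show ?thesis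
    by (rule that)
qed

text \<open>At position \<open>0\<close> the convolution sets \<open>u k\<close> against the
  coefficient at \<open>- k\<close>, which is the distributional pairing up to
  normalisation.\<close>

lemma fourier_pairing_eq_spectral_conv: "fourier_pairing u g = of_real (1 / sqrt (2 * pi)) * spectral_conv u g 0"
  unfolding fourier_pairing_def spectral_conv_def inverse_fourier_def fourier_coeff_def[symmetric]
  by (subst infsum_cmult_right'[symmetric]) (simp add: mult.left_commute del: of_real_divide)

section \<open>The inverse multiplier and its powers\<close>

text \<open>Equal to \<open>(e\<^sup>i\<^sup>t + i) / (1 + i e\<^sup>i\<^sup>t)\<close>: the row equation of a discrete holomorphic function
  divides the mode \<open>e\<^sup>i\<^sup>m\<^sup>t\<close> by \<open>mu t\<close>. The junk value at \<open>sin t = 1\<close> is \<open>0\<close>.\<close>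

definition mu :: "real \<Rightarrow> real" where "mu t = cos t / (1 - sin t)"

text \<open>Here \<open>mu t\<close> is \<open>tan (pi / 4 + t / 2)\<close>, whose derivative is
  half of one plus its square. In this form the derivatives of powers of \<open>mu\<close> are again
  polynomials in \<open>mu\<close>.\<close>

lemma mu_deriv:
  assumes "sin t \<noteq> 1"
  shows "(mu has_real_derivative (1 + (mu t)\<^sup>2) / 2) (at t within S)"
proof -
  have c: "(cos t)\<^sup>2 = 1 - (sin t)\<^sup>2" by (simp add: cos_squared_eq)
  have "((\<lambda>t. cos t / (1 - sin t)) has_real_derivative
     ((- sin t) * (1 - sin t) - cos t * (- cos t)) / ((1 - sin t) * (1 - sin t))) (at t within S)"
    by (rule derivative_eq_intros refl | use assms in simp)+
  moreover have "((- sin t) * (1 - sin t) - cos t * (- cos t)) / ((1 - sin t) * (1 - sin t))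
      = (1 + (mu t)\<^sup>2) / 2"
  proof -
    have nz: "1 - sin t \<noteq> 0" using assms by simp
    have "(- sin t) * (1 - sin t) - cos t * (- cos t) = 1 - sin t"
      using c by (simp add: power2_eq_square algebra_simps)
    moreover have "(1 + (mu t)\<^sup>2) / 2 = 1 / (1 - sin t)"
    proof -
      have "(mu t)\<^sup>2 = ((1 - sin t) * (1 + sin t)) / ((1 - sin t) * (1 - sin t))"
        unfolding mu_def power_divide c by (simp add: power2_eq_square algebra_simps)
      also have "\<dots> = (1 + sin t) / (1 - sin t)" using nz by simp
      finally show ?thesis using nz by (simp add: field_simps)
    qed
    ultimately show ?thesis by (simp only: nonzero_divide_mult_cancel_left[OF nz])
  qed
  ultimately show ?thesis unfolding mu_def[abs_def] by (simp only:)
qed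

text \<open>\<open>cos^2\<close> factors as \<open>(1 - sin) (1 + sin)\<close>, and the second
  factor is smaller than the first where \<open>sin\<close> is negative.\<close>

lemma abs_mu_less_1:
  assumes "sin t < 0"
  shows "\<bar>mu t\<bar> < 1"
proof -
  have "(cos t)\<^sup>2 = (1 - sin t) * (1 + sin t)"
    by (simp add: cos_squared_eq power2_eq_square algebra_simps)
  also have "\<dots> < (1 - sin t) * (1 - sin t)"
    by (rule mult_strict_left_mono) (use assms in auto)
  finally have "(cos t)\<^sup>2 < (1 - sin t)\<^sup>2" by (simp add: power2_eq_square)
  then have "\<bar>cos t\<bar> < \<bar>1 - sin t\<bar>" using assms abs_le_square_iff[of "1 - sin t" "cos t"] by linarith
  then show ?thesis using assms by (simp add: mu_def abs_divide divide_less_eq)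
qed

text \<open>These identities replace a division by the row symbols: for
  \<open>h = (1 - i mu) g / 2\<close> they give \<open>(1 + i e^(it)) h = g\<close> and
  \<open>(e^(it) + i) h = mu g\<close>.\<close>

lemma mu_factorization:
  assumes "sin t \<noteq> 1"
  shows "(1 + \<i> * eit t) * (1 - \<i> * of_real (mu t)) = 2"
    and "(eit t + \<i>) * (1 - \<i> * of_real (mu t)) = 2 * of_real (mu t)"
proof -
  have E: "eit t = Complex (cos t) (sin t)"
    by (simp add: complex_eq_iff Re_exp Im_exp)
  have m1: "mu t * (1 - sin t) = cos t"
    using assms by (simp add: mu_def)
  have "(1 - sin t) * (mu t * cos t) = (mu t * (1 - sin t)) * cos t"
    by (simp only: mult_ac)
  also have "\<dots> = (1 - sin t) * (1 + sin t)"
    unfolding m1 using sin_cos_squared_add3[of t] by (simp add: algebra_simps)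
  finally have "(1 - sin t) * (mu t * cos t) = (1 - sin t) * (1 + sin t)" .
  then have m2: "mu t * cos t = 1 + sin t" using assms by simp
  show "(1 + \<i> * eit t) * (1 - \<i> * of_real (mu t)) = 2"
    unfolding E using m1 m2 by (simp add: complex_eq_iff algebra_simps)
  show "(eit t + \<i>) * (1 - \<i> * of_real (mu t)) = 2 * of_real (mu t)"
    unfolding E using m1 m2 by (simp add: complex_eq_iff algebra_simps)
qed

text \<open>The decay criterion with \<open>N = 1\<close> and \<open>C = 2 * pi * B\<close>.\<close>

lemma wiener_of_C2:
  fixes g g1 g2 :: "real \<Rightarrow> complex"
  assumes d1: "\<And>t. t \<in> {-pi..pi} \<Longrightarrow> (g has_vector_derivative g1 t) (at t within {-pi..pi})"
    and d2: "\<And>t. t \<in> {-pi..pi} \<Longrightarrow> (g1 has_vector_derivative g2 t) (at t within {-pi..pi})"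
    and ends: "g (-pi) = g pi" "g1 (-pi) = g1 pi"
    and B0: "\<And>t. t \<in> {-pi..pi} \<Longrightarrow> cmod (g t) \<le> B"
    and B: "\<And>t. t \<in> {-pi..pi} \<Longrightarrow> cmod (g2 t) \<le> B"
  shows "g \<in> wiener" "(\<Sum>\<^sub>\<infinity>k. cmod (fourier_coeff g k)) \<le> 10 * pi * B"
proof -
  have cg: "continuous_on {-pi..pi} g"
    using d1 by (meson continuous_on_eq_continuous_within has_vector_derivative_continuous)
  have "0 \<le> B" using B[of 0] norm_ge_zero[of "g2 0"] by (simp del: norm_ge_zero)
  then have *: "0 \<le> 2 * pi * B" by simp
  have b1: "cmod (fourier_coeff g k) \<le> 2 * pi * B / real 1" for k
    using fourier_coeff_bound[OF cg B0] by simp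
  have b2: "cmod (fourier_coeff g k) * (real_of_int k)\<^sup>2 \<le> 2 * pi * B * real 1" for k
    using fourier_coeff_second_derivative_bound[OF d1 d2 ends B] by simp
  show "g \<in> wiener"
    using decay_abs_summable(1)[OF _ * b1 b2] cg by (simp add: wiener_def)
  show "(\<Sum>\<^sub>\<infinity>k. cmod (fourier_coeff g k)) \<le> 10 * pi * B"
    using decay_abs_summable(2)[OF _ * b1 b2] by simp
qed

lemma torus_test_function_derivatives:
  assumes "\<psi> \<in> torus_test_functions"
  obtains \<psi>1 \<psi>2 where "\<And>t. (\<psi> has_vector_derivative \<psi>1 t) (at t)"
    "\<And>t. (\<psi>1 has_vector_derivative \<psi>2 t) (at t)" "continuous_on UNIV \<psi>2"
proof -
  let ?D = "\<lambda>(g :: real \<Rightarrow> complex) s. vector_derivative g (at s)"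
  have d: "(?D ^^ k) \<psi> differentiable (at t)" for k t
    using assms by (simp add: torus_test_functions_def)
  show ?thesis
  proof (rule that)
    show "(\<psi> has_vector_derivative ?D \<psi> t) (at t)" for t
      using d[of 0] by (simp add: vector_derivative_works)
    show "(?D \<psi> has_vector_derivative ?D (?D \<psi>) t) (at t)" for t
      using d[of 1] by (simp add: vector_derivative_works)
    show "continuous_on UNIV (?D (?D \<psi>))"
      using d[of 2] by (auto simp: numeral_2_eq_2 continuous_on_eq_continuous_at
          intro: differentiable_imp_continuous_within)
  qed
qed

lemma has_vector_derivative_zero_off_support:
  assumes "(\<psi> has_vector_derivative d) (at t)" "open U" "t \<in> U" "\<And>s. s \<in> U \<Longrightarrow> \<psi> s = 0"
  shows "d = (0::complex)"
proof -
  have "((\<lambda>_. 0) has_vector_derivative d) (at t)"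
    using has_vector_derivative_transform_within_open[OF assms(1-3), of "\<lambda>_. 0"] assms(4) by simp
  then show ?thesis
    using vector_derivative_unique_at has_vector_derivative_const by blast
qed

text \<open>First derivative of \<open>mu^n\<close>, followed by the second. Wherever
  \<open>n - 1\<close> or \<open>n - 2\<close> is truncated, the numerical factor in front is
  zero.\<close>

definition mu_pow' :: "nat \<Rightarrow> real \<Rightarrow> real" where
  "mu_pow' n t = real n * mu t ^ (n - 1) * ((1 + (mu t)\<^sup>2) / 2)"

definition mu_pow'' :: "nat \<Rightarrow> real \<Rightarrow> real" where
  "mu_pow'' n t = real n * real (n - 1) * mu t ^ (n - 2) * ((1 + (mu t)\<^sup>2) / 2)\<^sup>2 +
     real n * mu t ^ (n - 1) * (mu t * ((1 + (mu t)\<^sup>2) / 2))"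

lemma mu_power_deriv:
  assumes "sin t \<noteq> 1"
  shows "((\<lambda>t. mu t ^ n) has_real_derivative mu_pow' n t) (at t)"
    and "(mu_pow' n has_real_derivative mu_pow'' n t) (at t)"
proof -
  note d = mu_deriv[OF assms]
  show "((\<lambda>t. mu t ^ n) has_real_derivative mu_pow' n t) (at t)"
    unfolding mu_pow'_def by (rule derivative_eq_intros d refl | simp)+
  show "(mu_pow' n has_real_derivative mu_pow'' n t) (at t)"
  proof (cases n)
    case (Suc j)
    show ?thesis unfolding Suc mu_pow'_def mu_pow''_def
      by (rule derivative_eq_intros d refl | simp)+
        (simp add: algebra_simps power2_eq_square add_divide_distrib numeral_2_eq_2)
  qed (simp add: mu_pow'_def[abs_def] mu_pow''_def)
qed

lemma has_vector_derivative_of_real_complex: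
  assumes "(f has_real_derivative d) (at t)"
  shows "((\<lambda>t. of_real (f t)) has_vector_derivative (of_real d :: complex)) (at t)"
  using assms
  by (intro has_vector_derivative_of_real) (simp add: has_real_derivative_iff_has_vector_derivative)

text \<open>A shift of the row by one can be moved onto the symbol as a factor
  \<open>e^(it)\<close>, so the two sides of the row equation become the factors
  \<open>1 + i e^(it)\<close> and \<open>e^(it) + i\<close>.\<close>

lemma Hol_spectral_conv_step:
  assumes "f \<in> Hol" and B: "\<And>m n. cmod (f m n) \<le> B" and h: "h \<in> wiener"
  shows "spectral_conv (\<lambda>m. f m n) (\<lambda>t. (1 + \<i> * eit t) * h t) 0 =
         spectral_conv (\<lambda>m. f m (n + 1)) (\<lambda>t. (eit t + \<i>) * h t) 0"
proof -
  have eq: "f m n + \<i> * f (m + 1) n = f (m + 1) (n + 1) + \<i> * f m (n + 1)" for m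
  proof -
    have "f m n + \<i> * f (m + 1) n - f (m + 1) (n + 1) - \<i> * f m (n + 1) = 0"
      using assms(1) by (simp only: Hol_def mem_Collect_eq)
    then show ?thesis by (simp add: diff_eq_eq)
  qed
  have L: "spectral_conv (\<lambda>m. f m j) (\<lambda>t. a * h t + b * (eit t * h t)) 0 =
      spectral_conv (\<lambda>m. a * f m j + b * f (m + 1) j) h 0" for a b j
  proof -
    have "spectral_conv (\<lambda>m. f m j) (\<lambda>t. a * h t + b * (eit t * h t)) 0 =
        a * spectral_conv (\<lambda>m. f m j) h 0 + b * spectral_conv (\<lambda>m. f m j) h 1"
      using spectral_conv_add[OF wiener_cmult[OF h, of a] wiener_cmult[OF wiener_shift[OF h], of b], of "\<lambda>m. f m j" B 0] B
      by (simp add: spectral_conv_cmult spectral_conv_shift)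
    also have "\<dots> = spectral_conv (\<lambda>m. a * f m j) h 0 + spectral_conv (\<lambda>m. b * f (m + 1) j) h 0"
      by (simp add: spectral_conv_cmult_left spectral_conv_shift_left[of "\<lambda>m. f m j"])
    also have "\<dots> = spectral_conv (\<lambda>m. a * f m j + b * f (m + 1) j) h 0"
    proof (rule spectral_conv_add_left[OF h, symmetric])
      show "cmod (a * f k j) \<le> cmod a * B" "cmod (b * f (k + 1) j) \<le> cmod b * B" for k
        using B by (auto simp: norm_mult intro: mult_left_mono)
    qed
    finally show ?thesis .
  qed
  have "spectral_conv (\<lambda>m. f m n) (\<lambda>t. (1 + \<i> * eit t) * h t) 0 = spectral_conv (\<lambda>m. f m n + \<i> * f (m + 1) n) h 0"
    using L[of n 1 \<i>] by (simp add: algebra_simps)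
  also have "\<dots> = spectral_conv (\<lambda>m. \<i> * f m (n + 1) + 1 * f (m + 1) (n + 1)) h 0"
    by (simp only: eq mult_1 add.commute)
  also have "\<dots> = spectral_conv (\<lambda>m. f m (n + 1)) (\<lambda>t. (eit t + \<i>) * h t) 0"
    using L[of "n + 1" \<i> 1] by (simp add: algebra_simps)
  finally show ?thesis .
qed

lemma Hp_spectrum:
  assumes p: "1 \<le> p" and f: "f \<in> Hp p"
    and \<psi>: "\<psi> \<in> torus_test_functions" and supp: "torus_support \<psi> \<subseteq> {-pi<..<0}"
  shows "spectral_conv (\<lambda>m. f m 0) \<psi> 0 = 0"
proof -
  obtain B where B: "\<And>m n. cmod (f m n) \<le> B" using Hp_bounded[OF p f] by blast
  have fH: "f \<in> Hol" using f by (simp add: Hp_def)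
  obtain \<psi>1 \<psi>2 where d1: "\<And>t. (\<psi> has_vector_derivative \<psi>1 t) (at t)"
    and d2: "\<And>t. (\<psi>1 has_vector_derivative \<psi>2 t) (at t)" and c2: "continuous_on UNIV \<psi>2"
    using torus_test_function_derivatives[OF \<psi>] by blast
  have c0: "continuous_on UNIV \<psi>" and c1: "continuous_on UNIV \<psi>1"
    using d1 d2 by (meson continuous_on_eq_continuous_within has_vector_derivative_continuous
        has_vector_derivative_at_within)+
  \<comment> \<open>The complement of this closure is open, so the derivatives of
    \<open>\<psi>\<close> vanish there as well.\<close>
  define Z where "Z = closure {t. \<psi> t \<noteq> 0}"
  have sinZ: "sin t < 0" if "t \<in> Z" "t \<in> {-pi..pi}" for t
  proof -
    have "-pi < t" "t < 0" using supp that by (auto simp: torus_support_def Z_def)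
    then show ?thesis using sin_gt_zero[of "-t"] by simp
  qed
  have z0: "\<psi> t = 0" if "t \<in> - Z" for t
    using that closure_subset[of "{t. \<psi> t \<noteq> 0}"] by (auto simp: Z_def)
  have oZ: "open (- Z)" unfolding Z_def by (intro open_Compl closed_closure)
  have z1: "\<psi>1 t = 0" if "t \<in> - Z" for t
    by (rule has_vector_derivative_zero_off_support[OF d1 oZ that z0])
  have z2: "\<psi>2 t = 0" if "t \<in> - Z" for t
    by (rule has_vector_derivative_zero_off_support[OF d2 oZ that z1])
  \<comment> \<open>Since \<open>sin\<close> vanishes at both ends, neither lies in the support;
    this supplies the equal end values required for integration by parts.\<close>
  have endsZ: "pi \<in> - Z" "- pi \<in> - Z"
    using sinZ[of pi] sinZ[of "-pi"] by auto
  obtain M where M: "\<And>t. t \<in> {-pi..pi} \<Longrightarrow> cmod (\<psi> t) \<le> M \<and> cmod (\<psi>1 t) \<le> M \<and> cmod (\<psi>2 t) \<le> M"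
  proof -
    have "\<exists>M. \<forall>t\<in>{-pi..pi}. cmod (h t) \<le> M" if "continuous_on UNIV h" for h
      using compact_imp_bounded[OF compact_continuous_image[OF continuous_on_subset[OF that subset_UNIV]
            compact_Icc[of "-pi" pi]]] by (auto simp: bounded_iff)
    from this[OF c0] this[OF c1] this[OF c2] obtain M0 M1 M2 where
      "\<forall>t\<in>{-pi..pi}. cmod (\<psi> t) \<le> M0" "\<forall>t\<in>{-pi..pi}. cmod (\<psi>1 t) \<le> M1"
      "\<forall>t\<in>{-pi..pi}. cmod (\<psi>2 t) \<le> M2" by blast
    then show ?thesis by (intro that[of "max M0 (max M1 M2)"]) force
  qed
  then have M0: "0 \<le> M" by (meson atLeastAtMost_iff neg_le_0_iff_le norm_ge_zero order_trans pi_ge_zero)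
  \<comment> \<open>Compactness of the support turns the pointwise bound
    \<open>\<bar>mu t\<bar> < 1\<close> into a uniform one.\<close>
  obtain r where r: "0 \<le> r" "r < 1" "\<And>t. t \<in> Z \<Longrightarrow> t \<in> {-pi..pi} \<Longrightarrow> \<bar>mu t\<bar> \<le> r"
  proof (cases "Z \<inter> {-pi..pi} = {}")
    case True
    then show ?thesis by (intro that[of 0]) auto
  next
    case False
    have "continuous_on (Z \<inter> {-pi..pi}) (\<lambda>t. \<bar>mu t\<bar>)"
      unfolding mu_def using sinZ by (fastforce intro!: continuous_intros)
    moreover have "compact (Z \<inter> {-pi..pi})"
      unfolding Z_def by (intro closed_Int_compact) auto
    ultimately obtain x where "x \<in> Z \<inter> {-pi..pi}" "\<forall>y\<in>Z \<inter> {-pi..pi}. \<bar>mu y\<bar> \<le> \<bar>mu x\<bar>"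
      using continuous_attains_sup[OF _ False] by blast
    then show ?thesis using abs_mu_less_1[OF sinZ] by (intro that[of "\<bar>mu x\<bar>"]) auto
  qed
  \<comment> \<open>The function \<open>\<psi> mu^n\<close> with its derivatives by the product
    rule. All three vanish off \<open>Z\<close>, in particular where \<open>mu\<close> is
    singular.\<close>
  define g g1 g2 where
    "g n t = \<psi> t * of_real (mu t ^ n)" and
    "g1 n t = \<psi> t * of_real (mu_pow' n t) + \<psi>1 t * of_real (mu t ^ n)" and
    "g2 n t = (\<psi> t * of_real (mu_pow'' n t) + \<psi>1 t * of_real (mu_pow' n t)) +
       (\<psi>1 t * of_real (mu_pow' n t) + \<psi>2 t * of_real (mu t ^ n))" for n :: nat and t
  have dg: "(g n has_vector_derivative g1 n t) (at t within {-pi..pi})"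
    and dg1: "(g1 n has_vector_derivative g2 n t) (at t within {-pi..pi})"
    if t: "t \<in> {-pi..pi}" for n t
  proof -
    have "(g n has_vector_derivative g1 n t) (at t) \<and> (g1 n has_vector_derivative g2 n t) (at t)"
    proof (cases "t \<in> Z")
      case True
      then have s: "sin t \<noteq> 1" using sinZ[OF True t] by auto
      show ?thesis
        unfolding g_def g1_def g2_def
        by (intro conjI has_vector_derivative_add has_vector_derivative_mult d1 d2
            has_vector_derivative_of_real_complex mu_power_deriv s)
    next
      case False
      have "g n s = 0" "g1 n s = 0" "g2 n s = 0" if "s \<in> - Z" for s
        using that z0 z1 z2 by (auto simp: g_def g1_def g2_def)
      then show ?thesis
        using has_vector_derivative_transform_within_open[OF has_vector_derivative_const oZ, of t 0 "g n"]
          has_vector_derivative_transform_within_open[OF has_vector_derivative_const oZ, of t 0 "g1 n"]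
          False by auto
    qed
    then show "(g n has_vector_derivative g1 n t) (at t within {-pi..pi})"
      "(g1 n has_vector_derivative g2 n t) (at t within {-pi..pi})"
      by (auto intro: has_vector_derivative_at_within)
  qed
  \<comment> \<open>The four terms of \<open>g2 n\<close> contribute \<open>n^2 + 2 n + 1\<close>,
    and \<open>n - 2\<close> is the lowest power of \<open>mu\<close> among them.\<close>
  define C where "C n = M * (real n + 1)\<^sup>2 * r ^ (n - 2)" for n
  have C0: "0 \<le> C n" for n using M0 r by (simp add: C_def)
  have bounds: "cmod (g n t) \<le> C n \<and> cmod (g2 n t) \<le> C n" if t: "t \<in> {-pi..pi}" for n t
  proof (cases "t \<in> Z")
    case False
    then show ?thesis using z0 z1 z2 C0 by (simp add: g_def g2_def)
  next
    case True
    let ?m = "\<bar>mu t\<bar>"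
    have m: "?m \<le> r" "?m \<le> 1" using r True t by force+
    have pw: "?m ^ j \<le> r ^ (n - 2)" if "n - 2 \<le> j" for j
    proof -
      have "?m ^ j \<le> ?m ^ (n - 2)" by (rule power_decreasing) (use m that in auto)
      also have "\<dots> \<le> r ^ (n - 2)" by (rule power_mono) (use m in auto)
      finally show ?thesis .
    qed
    define h where "h = (1 + (mu t)\<^sup>2) / 2"
    have h: "0 \<le> h" "h \<le> 1"
      using m(2) by (auto simp: h_def abs_square_le_1)
    let ?R = "r ^ (n - 2)"
    have R: "0 \<le> ?R" using r by simp
    have A0: "\<bar>mu t ^ n\<bar> \<le> ?R" using pw[of n] by (simp add: power_abs)
    have "?m ^ (n - 1) * h \<le> ?R * 1"
      by (rule mult_mono) (use pw[of "n - 1"] h R in auto)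
    then have A1: "\<bar>mu_pow' n t\<bar> \<le> real n * ?R"
      unfolding mu_pow'_def h_def[symmetric] abs_mult power_abs using h
      by (simp add: mult.assoc mult_left_mono)
    have "\<bar>mu_pow'' n t\<bar> \<le> real n * real (n - 1) * (?m ^ (n - 2) * h\<^sup>2) + real n * (?m ^ (n - 1) * (?m * h))"
      unfolding mu_pow''_def h_def[symmetric]
      by (rule order_trans[OF abs_triangle_ineq]) (use h in \<open>simp add: abs_mult power_abs mult.assoc\<close>)
    also have "\<dots> \<le> real n * real (n - 1) * (?R * 1) + real n * (?R * 1)"
      by (intro add_mono mult_left_mono mult_mono)
        (use pw[of "n - 1"] pw[of "n - 2"] h R m in \<open>auto simp: power_le_one mult_le_one\<close>)
    also have "\<dots> = (real n)\<^sup>2 * ?R"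
      by (cases n) (auto simp: algebra_simps power2_eq_square)
    finally have A2: "\<bar>mu_pow'' n t\<bar> \<le> (real n)\<^sup>2 * ?R" .
    have P: "cmod (z * of_real x) \<le> M * y" if "cmod z \<le> M" "\<bar>x\<bar> \<le> y" for z x y
      unfolding norm_mult norm_of_real by (rule mult_mono) (use that M0 in auto)
    have "cmod (g2 n t) \<le> (M * ((real n)\<^sup>2 * ?R) + M * (real n * ?R)) + (M * (real n * ?R) + M * ?R)"
      unfolding g2_def
      by (intro order_trans[OF norm_triangle_ineq] add_mono P A0 A1 A2) (use M[OF t] in auto)
    also have "\<dots> = C n" by (simp add: C_def power2_eq_square algebra_simps)
    finally have 2: "cmod (g2 n t) \<le> C n" .
    have "cmod (g n t) \<le> M * ?R" unfolding g_def by (rule P) (use M[OF t] A0 in auto)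
    also have "\<dots> \<le> M * (real n + 1)\<^sup>2 * ?R"
      using M0 R by (intro mult_right_mono) (auto simp: mult_le_cancel_left1)
    finally show ?thesis using 2 by (simp add: C_def)
  qed
  have ends: "g n (- pi) = g n pi" "g1 n (- pi) = g1 n pi" for n
    using endsZ z0 z1 by (auto simp: g_def g1_def)
  have W: "g n \<in> wiener" "(\<Sum>\<^sub>\<infinity>k. cmod (fourier_coeff (g n) k)) \<le> 10 * pi * C n" for n
    using wiener_of_C2[OF dg dg1 ends, of n "C n"] bounds by blast+
  have step: "spectral_conv (\<lambda>m. f m n) (g n) 0 = spectral_conv (\<lambda>m. f m (n + 1)) (g (n + 1)) 0" for n
  proof -
    \<comment> \<open>This is \<open>(1 - i mu) g n / 2\<close>, from which the two row symbols
      produce \<open>g n\<close> and \<open>g (n + 1)\<close>.\<close>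
    define h where "h t = (1 / 2) * g n t + (- \<i> / 2) * g (n + 1) t" for t
    have hW: "h \<in> wiener"
      unfolding h_def by (intro wiener_add wiener_cmult W)
    have *: "(1 + \<i> * eit t) * h t = g n t \<and> (eit t + \<i>) * h t = g (n + 1) t" if t: "t \<in> {-pi..pi}" for t
    proof (cases "t \<in> Z")
      case True
      then have s: "sin t \<noteq> 1" using sinZ[OF True t] by auto
      have h: "h t = (1 - \<i> * of_real (mu t)) * (g n t / 2)"
        by (simp add: h_def g_def algebra_simps)
      show ?thesis
        unfolding h mult.assoc[symmetric] mu_factorization[OF s]
        by (simp add: g_def)
    next
      case False
      then show ?thesis using z0 by (simp add: h_def g_def)
    qed
    have "spectral_conv (\<lambda>m. f m n) (g n) 0 = spectral_conv (\<lambda>m. f m n) (\<lambda>t. (1 + \<i> * eit t) * h t) 0"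
      by (rule spectral_conv_cong) (use * in auto)
    also have "\<dots> = spectral_conv (\<lambda>m. f m (n + 1)) (\<lambda>t. (eit t + \<i>) * h t) 0"
      by (rule Hol_spectral_conv_step[OF fH B hW])
    also have "\<dots> = spectral_conv (\<lambda>m. f m (n + 1)) (g (n + 1)) 0"
      by (rule spectral_conv_cong) (use * in auto)
    finally show ?thesis .
  qed
  have all: "spectral_conv (\<lambda>m. f m n) (g n) 0 = spectral_conv (\<lambda>m. f m 0) \<psi> 0" for n
  proof (induction n)
    case 0
    then show ?case by (simp add: g_def[abs_def])
  next
    case (Suc n)
    then show ?case using step[of n] by simp
  qed
  have B0: "0 \<le> B" using B[of 0 0] norm_ge_zero order_trans by blast
  \<comment> \<open>By \<open>all\<close> the left side does not depend on \<open>n\<close>, so it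
    suffices that the right side tends to zero.\<close>
  have le: "cmod (spectral_conv (\<lambda>m. f m 0) \<psi> 0) \<le> B * (10 * pi * C n)" for n
    using spectral_conv_bound[OF W(1), of "\<lambda>m. f m n" B n 0] B W(2)[of n] B0 unfolding all
    by (meson mult_left_mono order_trans)
  have "(\<lambda>n. (real n + 1)\<^sup>2 * r ^ (n - 2)) \<longlonglongrightarrow> 0"
  \<comment> \<open>The offset removes the truncated subtraction in the exponent.\<close>
  proof (rule LIMSEQ_offset[where k = 2])
    have "(\<lambda>n. (real n + 3)\<^sup>2 * r ^ n) \<longlonglongrightarrow> 0"
    \<comment> \<open>For \<open>r = 0\<close> the sequence is zero from index \<open>1\<close> on;
      for \<open>r > 0\<close> the geometric decay beats the square.\<close>
    proof (cases "r = 0")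
      case True
      then show ?thesis
        by (intro tendsto_eventually eventually_sequentiallyI[of 1]) auto
    next
      case False
      then show ?thesis using r by real_asymp
    qed
    then show "(\<lambda>n. (real (n + 2) + 1)\<^sup>2 * r ^ (n + 2 - 2)) \<longlonglongrightarrow> 0"
      by (simp add: add.commute)
  qed
  then have "(\<lambda>n. B * (10 * pi * M) * ((real n + 1)\<^sup>2 * r ^ (n - 2))) \<longlonglongrightarrow> 0"
    by (rule tendsto_mult_right_zero)
  moreover have "B * (10 * pi * C n) = B * (10 * pi * M) * ((real n + 1)\<^sup>2 * r ^ (n - 2))" for n
    by (simp add: C_def)
  ultimately have "(\<lambda>n. B * (10 * pi * C n)) \<longlonglongrightarrow> 0" by (simp only:)
  then have "cmod (spectral_conv (\<lambda>m. f m 0) \<psi> 0) \<le> 0"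
    by (rule LIMSEQ_le_const) (use le in auto)
  then show ?thesis by simp
qed

section \<open>Convolution on \<open>lp\<close> and cancellation of multipliers\<close>

text \<open>Convexity of the power on the open half-line. At \<open>x = 0\<close> the claim reduces
  to \<open>(1 - p) * y powr p \<le> 0\<close>.\<close>

lemma powr_above_tangent:
  fixes x y p :: real
  assumes "1 \<le> p" "0 < y" "0 \<le> x"
  shows "y powr p + p * y powr (p - 1) * (x - y) \<le> x powr p"
proof (cases "x = 0")
  case True
  have "y powr (p - 1) * y = y powr p"
    using assms powr_add[of y "p - 1" 1] by simp
  then have "y powr p + p * y powr (p - 1) * (x - y) = y powr p - p * y powr p"
    using True by (simp add: algebra_simps)
  also have "\<dots> \<le> 0" using assms by (simp add: mult_le_cancel_right1)
  finally show ?thesis using True by simp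
next
  case False
  have "x powr p - y powr p \<ge> p * y powr (p - 1) * (x - y)"
  proof (rule convex_on_imp_above_tangent[OF powr_convex[OF assms(1)]])
    show "((\<lambda>x. x powr p) has_field_derivative p * y powr (p - 1)) (at y within {0<..})"
      using has_real_derivative_powr[OF assms(2), of p] by (rule has_field_derivative_at_within)
  qed (use assms False in \<open>auto simp: interior_open\<close>)
  then show ?thesis by simp
qed

text \<open>Hoelder's inequality in Jensen's form: the tangent inequality for the power is summed
  against the weights \<open>w\<close>.\<close>

lemma infsum_powr_le:
  fixes w x :: "'a \<Rightarrow> real"
  assumes p: "1 \<le> p" and w: "\<And>k. 0 \<le> w k" "w summable_on UNIV" and x: "\<And>k. 0 \<le> x k"
    and s1: "(\<lambda>k. w k * x k) summable_on UNIV" and sp: "(\<lambda>k. w k * x k powr p) summable_on UNIV"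
  shows "(\<Sum>\<^sub>\<infinity>k. w k * x k) powr p \<le> (\<Sum>\<^sub>\<infinity>k. w k) powr (p - 1) * (\<Sum>\<^sub>\<infinity>k. w k * x k powr p)"
proof -
  define W A where "W = (\<Sum>\<^sub>\<infinity>k. w k)" and "A = (\<Sum>\<^sub>\<infinity>k. w k * x k)"
  have nn: "0 \<le> (\<Sum>\<^sub>\<infinity>k. w k * x k powr p)" by (intro infsum_nonneg mult_nonneg_nonneg w) auto
  have A0: "0 \<le> A" unfolding A_def by (intro infsum_nonneg mult_nonneg_nonneg w x)
  have W0: "0 \<le> W" unfolding W_def by (intro infsum_nonneg w)
  show ?thesis
  proof (cases "A = 0")
    case True
    then show ?thesis using nn p unfolding A_def by simp
  next
    case False
    then have A: "0 < A" using A0 by simp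
    \<comment> \<open>If the total weight were zero, every weight and hence \<open>A\<close> would
      be zero.\<close>
    have W: "0 < W"
    proof (rule ccontr)
      assume "\<not> 0 < W"
      then have "W = 0" using W0 by simp
      then have "w k = 0" for k
        using finite_sum_le_infsum[OF w(2), of "{k}"] w(1) by (simp add: W_def antisym)
      then show False using A by (simp add: A_def)
    qed
    \<comment> \<open>At the weighted mean the linear part of the tangent sums to zero, which leaves
      \<open>y powr p * W\<close>.\<close>
    define y where "y = A / W"
    have y: "0 < y" using A W by (simp add: y_def)
    let ?c = "y powr p - p * y powr (p - 1) * y"
    have s2: "(\<lambda>k. ?c * w k + p * y powr (p - 1) * (w k * x k)) summable_on UNIV"
      by (intro summable_on_add summable_on_cmult_right w s1)
    have "?c * W + p * y powr (p - 1) * A = (\<Sum>\<^sub>\<infinity>k. ?c * w k + p * y powr (p - 1) * (w k * x k))"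
      unfolding W_def A_def
      by (subst infsum_add) (auto intro!: summable_on_cmult_right w s1 simp: infsum_cmult_right')
    also have "\<dots> \<le> (\<Sum>\<^sub>\<infinity>k. w k * x k powr p)"
    proof (rule infsum_mono[OF s2 sp])
      fix k
      have "w k * (y powr p + p * y powr (p - 1) * (x k - y)) \<le> w k * x k powr p"
        by (intro mult_left_mono powr_above_tangent p y x w)
      then show "?c * w k + p * y powr (p - 1) * (w k * x k) \<le> w k * x k powr p"
        by (simp add: algebra_simps)
    qed
    finally have le: "?c * W + p * y powr (p - 1) * A \<le> (\<Sum>\<^sub>\<infinity>k. w k * x k powr p)" .
    have "y * W = A" using W by (simp add: y_def)
    then have "?c * W + p * y powr (p - 1) * A = y powr p * W" by (simp add: algebra_simps)
    then have le': "y powr p * W \<le> (\<Sum>\<^sub>\<infinity>k. w k * x k powr p)" using le by simp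
    have "A powr p = (W * y) powr p" using \<open>y * W = A\<close> by (simp add: mult.commute)
    also have "\<dots> = W powr p * y powr p" by (rule powr_mult)
    also have "W powr p = W powr (p - 1) * W" using W powr_add[of W "p - 1" 1] by simp
    finally have "A powr p = W powr (p - 1) * (y powr p * W)" by (simp add: mult_ac)
    also have "\<dots> \<le> W powr (p - 1) * (\<Sum>\<^sub>\<infinity>k. w k * x k powr p)"
      by (rule mult_left_mono[OF le']) simp
    finally show ?thesis unfolding A_def W_def .
  qed
qed

lemma sum_infsum_swap:
  fixes f :: "'a \<Rightarrow> 'b \<Rightarrow> real"
  assumes "finite F" "\<And>m. m \<in> F \<Longrightarrow> f m summable_on A"
  shows "(\<lambda>k. \<Sum>m\<in>F. f m k) summable_on A \<and> (\<Sum>\<^sub>\<infinity>k\<in>A. \<Sum>m\<in>F. f m k) = (\<Sum>m\<in>F. infsum (f m) A)"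
  using assms by (induction F rule: finite_induct) (auto simp: infsum_add intro: summable_on_add)

text \<open>Young's inequality for \<open>l^1\<close> and \<open>l^p\<close>. The weighted power
  inequality with weights \<open>a (m - k)\<close> bounds each value, and summing over
  \<open>m\<close> before \<open>k\<close> yields the remaining factor \<open>A\<close>.\<close>

lemma spectral_conv_lp:
  assumes p: "1 \<le> p" and g: "g \<in> wiener" and u: "u \<in> lp p"
  shows "(\<lambda>m. cmod (spectral_conv u g m) powr p) summable_on UNIV"
    and "(\<Sum>\<^sub>\<infinity>m. cmod (spectral_conv u g m) powr p) \<le> (\<Sum>\<^sub>\<infinity>k. cmod (fourier_coeff g k)) powr p * (\<Sum>\<^sub>\<infinity>k. cmod (u k) powr p)"
proof -
  define a where "a k = cmod (fourier_coeff g k)" for k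
  define A where "A = (\<Sum>\<^sub>\<infinity>k. a k)"
  let ?U = "\<Sum>\<^sub>\<infinity>k. cmod (u k) powr p"
  have sa: "a summable_on UNIV" using g by (simp add: wiener_def a_def[abs_def])
  have sam: "(\<lambda>k. a (m - k)) summable_on UNIV" for m by (simp add: summable_int_reflect sa)
  have a0: "0 \<le> a k" for k by (simp add: a_def)
  have A0: "0 \<le> A" unfolding A_def by (intro infsum_nonneg a0)
  have aA: "(\<Sum>m\<in>F. a (m - k)) \<le> A" if "finite F" for F k
  proof -
    have "(\<Sum>m\<in>F. a (m - k)) = (\<Sum>j\<in>(\<lambda>m. m - k) ` F. a j)"
      by (simp add: sum.reindex inj_on_def)
    also have "\<dots> \<le> A" unfolding A_def by (rule finite_sum_le_infsum[OF sa]) (use that a0 in auto)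
    finally show ?thesis .
  qed
  have su: "(\<lambda>k. cmod (u k) powr p) summable_on UNIV" using u lp_norm_finite_iff[of p u] by (auto simp: lp_def)
  obtain B where B: "\<And>k. cmod (u k) \<le> B" using lp_bounded[OF p u] by blast
  have sp: "(\<lambda>k. a (m - k) * cmod (u k) powr p) summable_on UNIV" for m
    by (rule summable_on_comparison_test[OF summable_on_cmult_right[OF su, of A]])
       (use aA[of "{m}"] a0 in \<open>auto intro!: mult_right_mono\<close>)
  have s1: "(\<lambda>k. a (m - k) * cmod (u k)) summable_on UNIV" for m
    using spectral_conv_summable[OF g B, where m = m] by (simp add: norm_mult a_def mult.commute)
  have pt: "cmod (spectral_conv u g m) powr p \<le> A powr (p - 1) * (\<Sum>\<^sub>\<infinity>k. a (m - k) * cmod (u k) powr p)" for m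
  proof -
    have "cmod (spectral_conv u g m) \<le> (\<Sum>\<^sub>\<infinity>k. a (m - k) * cmod (u k))"
      using norm_infsum_bound[OF spectral_conv_summable[OF g B, where m = m]]
      by (simp add: spectral_conv_def norm_mult a_def mult.commute)
    then have "cmod (spectral_conv u g m) powr p \<le> (\<Sum>\<^sub>\<infinity>k. a (m - k) * cmod (u k)) powr p"
      by (intro powr_mono2) (use p in auto)
    also have "\<dots> \<le> (\<Sum>\<^sub>\<infinity>k. a (m - k)) powr (p - 1) * (\<Sum>\<^sub>\<infinity>k. a (m - k) * cmod (u k) powr p)"
      by (rule infsum_powr_le[OF p a0 sam _ s1 sp]) simp
    finally show ?thesis by (simp add: A_def infsum_int_reflect)
  qed
  have fin: "(\<Sum>m\<in>F. cmod (spectral_conv u g m) powr p) \<le> A powr p * ?U" if F: "finite F" for F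
  proof -
    note sw = sum_infsum_swap[OF F, of "\<lambda>m k. a (m - k) * cmod (u k) powr p", OF sp]
    have "(\<Sum>m\<in>F. cmod (spectral_conv u g m) powr p) \<le>
        A powr (p - 1) * (\<Sum>m\<in>F. \<Sum>\<^sub>\<infinity>k. a (m - k) * cmod (u k) powr p)"
      unfolding sum_distrib_left by (rule sum_mono) (rule pt)
    also have "(\<Sum>m\<in>F. \<Sum>\<^sub>\<infinity>k. a (m - k) * cmod (u k) powr p) =
        (\<Sum>\<^sub>\<infinity>k. \<Sum>m\<in>F. a (m - k) * cmod (u k) powr p)"
      using sw by simp
    also have "\<dots> \<le> (\<Sum>\<^sub>\<infinity>k. A * cmod (u k) powr p)"
      by (rule infsum_mono[OF conjunct1[OF sw] summable_on_cmult_right[OF su]])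
         (use aA[OF F] in \<open>auto simp: sum_distrib_right[symmetric] intro!: mult_right_mono\<close>)
    also have "\<dots> = A * ?U" by (simp add: infsum_cmult_right')
    also have "A powr (p - 1) * (A * ?U) = A powr p * ?U"
    proof (cases "A = 0")
      case False
      then show ?thesis using A0 powr_add[of A "p - 1" 1] by (simp add: mult.assoc[symmetric])
    qed simp
    finally show ?thesis by (simp add: mult_left_mono)
  qed
  show "(\<lambda>m. cmod (spectral_conv u g m) powr p) summable_on UNIV"
    by (rule nonneg_bdd_above_summable_on) (auto intro!: bdd_aboveI[of _ "A powr p * ?U"] fin)
  then show "(\<Sum>\<^sub>\<infinity>m. cmod (spectral_conv u g m) powr p) \<le> (\<Sum>\<^sub>\<infinity>k. cmod (fourier_coeff g k)) powr p * ?U"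
    unfolding a_def[symmetric] A_def[symmetric]
    by (rule infsum_le_finite_sums) (use fin in auto)
qed

section \<open>Symbols that annihilate a sequence\<close>

text \<open>The values at all \<open>m\<close> are the pairings with all \<open>e^(imt) g\<close>,
  so these are the symbols whose product with the Fourier transform of \<open>u\<close> is
  zero.\<close>

definition null_multipliers :: "(int \<Rightarrow> complex) \<Rightarrow> (real \<Rightarrow> complex) set" where
  "null_multipliers u = {g \<in> wiener. \<forall>m. spectral_conv u g m = 0}"

lemma wiener_cong:
  assumes "\<And>t. t \<in> {-pi..pi} \<Longrightarrow> g t = h t" "h \<in> wiener"
  shows "g \<in> wiener"
proof -
  have "fourier_coeff g k = fourier_coeff h k" for k by (rule fourier_coeff_cong) (rule assms)
  moreover have "continuous_on {-pi..pi} g \<longleftrightarrow> continuous_on {-pi..pi} h"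
    by (rule continuous_on_cong[OF refl]) (rule assms)
  ultimately show ?thesis using assms(2) by (simp add: wiener_def)
qed

lemma null_cong:
  assumes "\<And>t. t \<in> {-pi..pi} \<Longrightarrow> g t = h t" "h \<in> null_multipliers u"
  shows "g \<in> null_multipliers u"
proof -
  have "g \<in> wiener" by (rule wiener_cong) (use assms in \<open>auto simp: null_multipliers_def\<close>)
  moreover have "spectral_conv u g m = spectral_conv u h m" for m by (rule spectral_conv_cong) (rule assms)
  ultimately show ?thesis using assms(2) by (simp add: null_multipliers_def)
qed

abbreviation eit_inv :: "real \<Rightarrow> complex" where
  "eit_inv t \<equiv> exp (- (\<i> * of_real t))"

lemma eit_mult_eit_inv [simp]: "eit t * eit_inv t = 1"
  by (simp flip: exp_add)

lemma eit_cancel [simp]: "eit t * (eit_inv t * z) = z" "eit_inv t * (eit t * z) = z"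
  by (simp_all add: mult.assoc[symmetric] exp_minus_inverse)
   (simp_all add: exp_minus)

lemma wiener_shift_inv:
  assumes "g \<in> wiener"
  shows "(\<lambda>t. eit_inv t * g t) \<in> wiener"
proof -
  have "fourier_coeff (\<lambda>t. eit_inv t * g t) k = fourier_coeff g (k - 1)" for k
    using fourier_coeff_shift[of "\<lambda>t. eit_inv t * g t" "k - 1"] by simp
  then show ?thesis
    using assms summable_int_shift[of "\<lambda>k. cmod (fourier_coeff g k)" "-1"] unfolding wiener_def
    by (auto intro!: continuous_intros)
qed

lemma spectral_conv_shift_inv: "spectral_conv u (\<lambda>t. eit_inv t * g t) m = spectral_conv u g (m - 1)"
  using spectral_conv_shift[of u "\<lambda>t. eit_inv t * g t" "m - 1"] by simp

lemma sin_eq_eit: "of_real (sin t) = (\<i> / 2) * (eit_inv t - eit t)"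
  and cos_eq_eit: "of_real (cos t) = (eit t + eit_inv t) / 2"
  by (simp_all add: complex_eq_iff Re_exp Im_exp)

lemma wiener_sin: "g \<in> wiener \<Longrightarrow> (\<lambda>t. of_real (sin t) * g t) \<in> wiener"
  by (rule wiener_cong[OF _ wiener_add[OF wiener_cmult[OF wiener_shift_inv, of _ "\<i>/2"]
      wiener_cmult[OF wiener_shift, of _ "-\<i>/2"]], of _ g g]) (simp_all add: sin_eq_eit algebra_simps)

lemma wiener_1sin_power:
  assumes "g \<in> wiener"
  shows "(\<lambda>t. of_real ((1 - sin t) ^ n) * g t) \<in> wiener"
proof (induction n)
  case (Suc n)
  show ?case
    by (rule wiener_cong[OF _ wiener_add[OF Suc wiener_cmult[OF wiener_sin[OF Suc], of "-1"]]])
       (simp add: algebra_simps)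
qed (simp add: assms)

section \<open>Cancelling factors with zeros on the circle\<close>

context
  fixes p :: real and u :: "int \<Rightarrow> complex"
  assumes p: "1 \<le> p" and u: "u \<in> lp p"
begin

lemma null_lin:
  assumes "g \<in> null_multipliers u" "h \<in> null_multipliers u"
  shows "(\<lambda>t. a * g t + b * h t) \<in> null_multipliers u"
proof -
  obtain B where "\<And>k. cmod (u k) \<le> B" using lp_bounded[OF p u] by blast
  then show ?thesis
    using assms spectral_conv_add[of "\<lambda>t. a * g t" "\<lambda>t. b * h t" u B]
    by (auto simp: null_multipliers_def spectral_conv_cmult intro!: wiener_add wiener_cmult)
qed

lemma null_shift: "g \<in> null_multipliers u \<Longrightarrow> (\<lambda>t. eit t * g t) \<in> null_multipliers u"
  by (auto simp: null_multipliers_def wiener_shift spectral_conv_shift)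

lemma null_shift_inv: "g \<in> null_multipliers u \<Longrightarrow> (\<lambda>t. eit_inv t * g t) \<in> null_multipliers u"
  by (auto simp: null_multipliers_def wiener_shift_inv spectral_conv_shift_inv)

text \<open>The sequence \<open>spectral_conv u g\<close> then has constant modulus, and it lies in \<open>lp p\<close>.\<close>

lemma null_cancel:
  assumes g: "g \<in> wiener" and a: "cmod a = 1" and n: "(\<lambda>t. (eit t - a) * g t) \<in> null_multipliers u"
  shows "g \<in> null_multipliers u"
proof -
  obtain B where B: "\<And>k. cmod (u k) \<le> B" using lp_bounded[OF p u] by blast
  \<comment> \<open>On the convolution, the factor \<open>e^(it) - a\<close> acts as a first-order
    recurrence with ratio \<open>a\<close>.\<close>
  have eq: "spectral_conv u g (m + 1) = a * spectral_conv u g m" for m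
  proof -
    have "spectral_conv u (\<lambda>t. (eit t - a) * g t) m = spectral_conv u (\<lambda>t. eit t * g t + (- a) * g t) m"
      by (simp add: algebra_simps)
    also have "\<dots> = spectral_conv u g (m + 1) - a * spectral_conv u g m"
      using spectral_conv_add[OF wiener_shift[OF g] wiener_cmult[OF g, of "- a"], of u B m] B
        spectral_conv_cmult[of u "- a" g m]
      by (simp add: spectral_conv_shift)
    finally show ?thesis using n by (simp add: null_multipliers_def)
  qed
  have const: "cmod (spectral_conv u g m) = cmod (spectral_conv u g m')" for m m'
  proof -
    have "cmod (spectral_conv u g m) = cmod (spectral_conv u g 0)" for m
    proof (induction m rule: int_induct[where k = 0])
      case (step1 i)
      then show ?case using eq[of i] a by (simp add: norm_mult)
    next
      case (step2 i)
      then show ?case using eq[of "i - 1"] a by (simp add: norm_mult)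
    qed simp
    then show ?thesis by metis
  qed
  have "spectral_conv u g m = 0" for m
  proof (rule ccontr)
    assume "spectral_conv u g m \<noteq> 0"
    then have c: "0 < cmod (spectral_conv u g m) powr p" by simp
    let ?S = "\<Sum>\<^sub>\<infinity>m. cmod (spectral_conv u g m) powr p"
    \<comment> \<open>\<open>N\<close> equal positive terms already exceed the sum of the convergent
      series.\<close>
    obtain N :: nat where "?S < N * cmod (spectral_conv u g m) powr p"
      using reals_Archimedean3[OF c] by blast
    moreover have "(\<Sum>k\<in>{1..int N}. cmod (spectral_conv u g k) powr p) \<le> ?S"
      by (rule finite_sum_le_infsum[OF spectral_conv_lp(1)[OF p g u]]) auto
    moreover have "(\<Sum>k\<in>{1..int N}. cmod (spectral_conv u g k) powr p) = (\<Sum>k\<in>{1..int N}. cmod (spectral_conv u g m) powr p)"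
      by (rule sum.cong[OF refl]) (metis const)
    ultimately show False by simp
  qed
  then show ?thesis using g by (simp add: null_multipliers_def)
qed

lemma null_cos: "g \<in> null_multipliers u \<Longrightarrow> (\<lambda>t. of_real (cos t) * g t) \<in> null_multipliers u"
  by (rule null_cong[OF _ null_lin[OF null_shift null_shift_inv, of g g "1/2" "1/2"]])
     (simp_all add: cos_eq_eit field_simps)

text \<open>Both zeros of \<open>sin\<close> are simple:
  \<open>2 i e^(it) sin t = (e^(it) - 1) (e^(it) + 1)\<close>.\<close>

lemma null_sin_cancel:
  assumes g: "g \<in> wiener" and n: "(\<lambda>t. of_real (sin t) * g t) \<in> null_multipliers u"
  shows "g \<in> null_multipliers u"
proof -
  have "(\<lambda>t. (eit t - 1) * ((eit t - (-1)) * g t)) \<in> null_multipliers u"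
    by (rule null_cong[OF _ null_lin[OF null_shift[OF n] n, of "2 * \<i>" 0]])
       (simp add: sin_eq_eit algebra_simps)
  moreover have w: "(\<lambda>t. (eit t - (-1)) * g t) \<in> wiener"
    by (rule wiener_cong[OF _ wiener_add[OF wiener_shift[OF g] g]]) (simp add: algebra_simps)
  ultimately have "(\<lambda>t. (eit t - (-1)) * g t) \<in> null_multipliers u"
    by (intro null_cancel[OF w, of 1]) auto
  then show ?thesis by (intro null_cancel[OF g, of "-1"]) auto
qed

text \<open>The zero at \<open>pi / 2\<close> is double:
  \<open>- 2 i e^(it) (1 - sin t) = (e^(it) - i)^2\<close>.\<close>

lemma null_1sin_cancel:
  assumes g: "g \<in> wiener" and n: "(\<lambda>t. of_real (1 - sin t) * g t) \<in> null_multipliers u"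
  shows "g \<in> null_multipliers u"
proof -
  have "(\<lambda>t. (eit t - \<i>) * ((eit t - \<i>) * g t)) \<in> null_multipliers u"
    by (rule null_cong[OF _ null_lin[OF null_shift[OF n] n, of "- 2 * \<i>" 0]])
       (simp add: sin_eq_eit algebra_simps)
  moreover have w: "(\<lambda>t. (eit t - \<i>) * g t) \<in> wiener"
    by (rule wiener_cong[OF _ wiener_add[OF wiener_shift[OF g] wiener_cmult[OF g, of "-\<i>"]]])
      (simp add: algebra_simps)
  ultimately have "(\<lambda>t. (eit t - \<i>) * g t) \<in> null_multipliers u"
    by (intro null_cancel[OF w, of \<i>]) auto
  then show ?thesis by (intro null_cancel[OF g, of \<i>]) auto
qed

lemma null_1sin_power_cancel:
  assumes g: "g \<in> wiener" and n: "(\<lambda>t. of_real ((1 - sin t) ^ n) * g t) \<in> null_multipliers u"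
  shows "g \<in> null_multipliers u"
  using n
proof (induction n)
  case (Suc n)
  have "(\<lambda>t. of_real ((1 - sin t) ^ n) * g t) \<in> null_multipliers u"
    by (rule null_1sin_cancel[OF wiener_1sin_power[OF g]]) (use Suc.prems in \<open>simp add: mult.assoc\<close>)
  then show ?case by (rule Suc.IH)
qed simp

end

section \<open>Uniform bounds for the Poisson kernels\<close>

text \<open>Reflection folds the integral onto \<open>[-pi, 0]\<close>, the arc on which
  \<open>nu\<close> coincides with the smooth function \<open>mu\<close>.\<close>

lemma fourier_coeff_even:
  fixes g :: "real \<Rightarrow> real"
  assumes c: "continuous_on {-pi..pi} g" and ev: "\<And>t. g (- t) = g t"
  shows "fourier_coeff (\<lambda>t. of_real (g t)) k = of_real (2 * integral {-pi..0} (\<lambda>t. g t * cos (of_int k * t)))"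
proof -
  define F where "F t = complex_of_real (g t) * exp (\<i> * of_int k * of_real t)" for t
  have Fi: "F integrable_on {-pi..pi}"
    unfolding F_def by (intro fourier_coeff_integrable continuous_intros c)
  have F1: "F integrable_on {-pi..0}" and F2: "F integrable_on {0..pi}"
    by (rule integrable_on_subinterval[OF Fi]; auto)+
  have F3: "(\<lambda>t. F (- t)) integrable_on {-pi..0}"
    using F2 Henstock_Kurzweil_Integration.integrable_reflect_real[where f = F and a = 0 and b = pi] by simp
  have ci: "(\<lambda>t. g t * cos (of_int k * t)) integrable_on {-pi..0}"
    by (intro integrable_continuous_real continuous_intros continuous_on_subset[OF c]) auto
  have "fourier_coeff (\<lambda>t. of_real (g t)) k = integral {-pi..pi} F"
    unfolding fourier_coeff_def F_def[abs_def] ..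
  also have "\<dots> = integral {-pi..0} F + integral {0..pi} F"
    by (rule Henstock_Kurzweil_Integration.integral_combine[symmetric]) (use Fi in auto)
  also have "integral {0..pi} F = integral {-pi..0} (\<lambda>t. F (- t))"
    using Henstock_Kurzweil_Integration.integral_reflect_real[where a = 0 and b = pi and f = F] by simp
  also have "integral {-pi..0} F + integral {-pi..0} (\<lambda>t. F (- t)) = integral {-pi..0} (\<lambda>t. F t + F (- t))"
    by (rule Henstock_Kurzweil_Integration.integral_add[symmetric]) (fact F1 F3)+
  also have "(\<lambda>t. F t + F (- t)) = (\<lambda>t. of_real (2 * (g t * cos (of_int k * t))))"
  proof
    fix t
    have "exp (\<i> * of_int k * complex_of_real s) = cis (of_int k * s)" for s
      by (simp add: cis_conv_exp mult.assoc)
    note this[of t] this[of "- t"]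
    then show "F t + F (- t) = of_real (2 * (g t * cos (of_int k * t)))"
      unfolding F_def ev by (simp only:) (simp add: complex_eq_iff)
  qed
  also have "integral {-pi..0} (\<lambda>t. complex_of_real (2 * (g t * cos (of_int k * t)))) =
      of_real (integral {-pi..0} (\<lambda>t. 2 * (g t * cos (of_int k * t))))"
    using integral_linear[OF integrable_on_mult_right[OF ci, of 2] bounded_linear_of_real[where 'a = complex]]
    by (simp add: o_def)
  finally show ?thesis by simp
qed

section \<open>Integrals of powers of the multiplier over the lower arc\<close>

lemma mu_zero [simp]: "mu 0 = 1" and mu_minus_pi [simp]: "mu (- pi) = - 1"
  by (simp_all add: mu_def)

lemma sin_nonpos: "t \<in> {-pi..0} \<Longrightarrow> sin t \<le> 0"
  using sin_ge_zero[of "- t"] by simp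

lemma abs_mu_le_1: "t \<in> {-pi..0} \<Longrightarrow> \<bar>mu t\<bar> \<le> 1"
proof -
  assume t: "t \<in> {-pi..0}"
  show "\<bar>mu t\<bar> \<le> 1"
  proof (cases "sin t = 0")
    case True
    then have "\<bar>cos t\<bar> = 1" using sin_zero_abs_cos_one by blast
    then show ?thesis using True by (simp add: mu_def)
  next
    case False
    then show ?thesis using abs_mu_less_1[of t] sin_nonpos[OF t] by simp
  qed
qed

lemma continuous_on_mu [continuous_intros]: "continuous_on {-pi..0} mu"
proof -
  have "1 - sin t \<noteq> 0" if "t \<in> {-pi..0}" for t using sin_nonpos[OF that] by simp
  then show ?thesis unfolding mu_def[abs_def] by (intro continuous_intros) auto
qed

definition hmu :: "real \<Rightarrow> real" where "hmu t = (1 + (mu t)\<^sup>2) / 2"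

lemma hmu_bounds: "1 / 2 \<le> hmu t" "t \<in> {-pi..0} \<Longrightarrow> hmu t \<le> 1"
  using abs_mu_le_1[of t] by (auto simp: hmu_def abs_square_le_1)

text \<open>Up to the constant, this is the substitution \<open>x = mu t\<close>, since \<open>hmu\<close> is the derivative of \<open>mu\<close>;
  rounding the exponent down to an even number removes the modulus.\<close>

lemma integral_abs_mu_power:
  "integral {-pi..0} (\<lambda>t. \<bar>mu t\<bar> ^ j * hmu t) \<le> 4 / (real j + 1)"
proof -
  let ?m = "2 * (j div 2)"
  have hi: "((\<lambda>t. mu t ^ ?m * hmu t) has_integral
     mu 0 ^ (?m + 1) / real (?m + 1) - mu (-pi) ^ (?m + 1) / real (?m + 1)) {-pi..0}"
  proof (rule fundamental_theorem_of_calculus)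
    fix t :: real assume t: "t \<in> {-pi..0}"
    have s: "sin t \<noteq> 1" using sin_nonpos[OF t] by simp
    have "((\<lambda>t. mu t ^ (?m + 1) / real (?m + 1)) has_real_derivative
        (real (?m + 1) * hmu t * mu t ^ ?m) / real (?m + 1)) (at t within {-pi..0})"
      using DERIV_power[OF mu_deriv[OF s, of "{-pi..0}"], of "?m + 1"]
      by (intro DERIV_cdivide) (simp add: hmu_def mult_ac)
    then show "((\<lambda>t. mu t ^ (?m + 1) / real (?m + 1)) has_vector_derivative mu t ^ ?m * hmu t) (at t within {-pi..0})"
      unfolding has_real_derivative_iff_has_vector_derivative[symmetric]
      by (simp add: mult.commute)
  qed simp
  have "integral {-pi..0} (\<lambda>t. \<bar>mu t\<bar> ^ j * hmu t) \<le> integral {-pi..0} (\<lambda>t. mu t ^ ?m * hmu t)"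
  proof (rule integral_le)
    show "(\<lambda>t. \<bar>mu t\<bar> ^ j * hmu t) integrable_on {-pi..0}"
      unfolding hmu_def by (intro integrable_continuous_real continuous_intros continuous_on_mu) auto
    show "(\<lambda>t. mu t ^ ?m * hmu t) integrable_on {-pi..0}"
      using hi by blast
    fix t assume t: "t \<in> {-pi..0}"
    have "\<bar>mu t\<bar> ^ j \<le> \<bar>mu t\<bar> ^ ?m"
      by (rule power_decreasing) (use abs_mu_le_1[OF t] in auto)
    also have "\<dots> = mu t ^ ?m" by (simp add: power_mult)
    finally show "\<bar>mu t\<bar> ^ j * hmu t \<le> mu t ^ ?m * hmu t"
      by (rule mult_right_mono) (use hmu_bounds(1)[of t] in linarith)
  qed
  \<comment> \<open>The exponent \<open>?m + 1\<close> is odd and \<open>mu\<close> runs from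
    \<open>-1\<close> to \<open>1\<close>, so the two boundary terms add up.\<close>
  also have "\<dots> = 2 / (real ?m + 1)"
    using integral_unique[OF hi] by (simp add: power_mult add.commute)
  also have "\<dots> \<le> 4 / (real j + 1)"
  proof -
    \<comment> \<open>Rounding down loses at most one, which the doubled constant absorbs.\<close>
    have "j \<le> ?m + 1" by presburger
    then have "real j \<le> real ?m + 1" by (metis of_nat_1 of_nat_add of_nat_le_iff)
    then show ?thesis by (simp add: field_simps)
  qed
  finally show ?thesis .
qed

text \<open>The row multiplier on \<open>[0, pi]\<close> and its inverse \<open>mu\<close> on
  \<open>[-pi, 0]\<close>: on each arc the choice of modulus at most one. It is even, with corners
  at the multiples of \<open>pi\<close>.\<close>

definition nu :: "real \<Rightarrow> real" where "nu t = cos t / (1 + \<bar>sin t\<bar>)"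

lemma nu_eq_mu: "t \<in> {-pi..0} \<Longrightarrow> nu t = mu t"
  using sin_nonpos[of t] by (simp add: nu_def mu_def)

lemma continuous_on_nu: "continuous_on S nu"
proof -
  have "1 + \<bar>sin t\<bar> \<noteq> 0" for t :: real using abs_ge_zero[of "sin t"] by linarith
  then show ?thesis unfolding nu_def[abs_def] by (intro continuous_intros) auto
qed

text \<open>The first bound is the substitution \<open>x = mu t\<close>. The second integrates by
  parts twice: the second derivative of \<open>mu^n\<close> has size \<open>n^2 mu^(n - 2)\<close>,
  whose integral is only of order \<open>n\<close>, like the boundary terms at the corners.\<close>

lemma integral_mu_power_cos_bounds:
  fixes k :: int
  assumes n: "n \<ge> 1"
  defines "I \<equiv> integral {-pi..0} (\<lambda>t. mu t ^ n * cos (of_int k * t))"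
  shows "\<bar>I\<bar> \<le> 8 / real n" and "\<bar>I\<bar> * (real_of_int k)\<^sup>2 \<le> 10 * real n"
proof -
  have ci: "(\<lambda>t. mu t ^ n * cos (of_int k * t)) integrable_on {-pi..0}"
    by (intro integrable_continuous_real continuous_intros continuous_on_mu)
  have chi: "(\<lambda>t. \<bar>mu t\<bar> ^ j * hmu t) integrable_on {-pi..0}" for j
    unfolding hmu_def by (intro integrable_continuous_real continuous_intros continuous_on_mu) auto
  have "norm I \<le> integral {-pi..0} (\<lambda>t. 2 * (\<bar>mu t\<bar> ^ n * hmu t))"
    unfolding I_def
  proof (rule integral_norm_bound_integral[OF ci])
    show "(\<lambda>t. 2 * (\<bar>mu t\<bar> ^ n * hmu t)) integrable_on {-pi..0}"
      by (rule integrable_on_mult_right[OF chi])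
    fix t :: real
    \<comment> \<open>The inequality \<open>1 \<le> 2 * hmu t\<close> inserts the derivative needed
      for the substitution.\<close>
    have "\<bar>mu t\<bar> ^ n * \<bar>cos (of_int k * t)\<bar> \<le> \<bar>mu t\<bar> ^ n * (2 * hmu t)"
      by (intro mult_left_mono order_trans[OF abs_cos_le_one]) (use hmu_bounds(1)[of t] in auto)
    then show "norm (mu t ^ n * cos (of_int k * t)) \<le> 2 * (\<bar>mu t\<bar> ^ n * hmu t)"
      by (simp add: abs_mult power_abs)
  qed
  also have "\<dots> \<le> 2 * (4 / (real n + 1))"
    using integral_abs_mu_power[of n] by simp
  also have "\<dots> \<le> 8 / real n" using n by (simp add: field_simps)
  finally show "\<bar>I\<bar> \<le> 8 / real n" by simp
  show "\<bar>I\<bar> * (real_of_int k)\<^sup>2 \<le> 10 * real n"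
  proof (cases "k = 0")
    case False
    let ?K = "real_of_int k"
    \<comment> \<open>Both integrations by parts in one antiderivative; the terms with
      \<open>mu_pow' n t * sin (?K * t)\<close> cancel in its derivative.\<close>
    define F :: "real \<Rightarrow> real" where "F t = mu t ^ n * (?K * sin (?K * t)) + mu_pow' n t * cos (?K * t)" for t
    have dF: "(F has_vector_derivative (?K\<^sup>2 * (mu t ^ n * cos (?K * t)) + mu_pow'' n t * cos (?K * t))) (at t within {-pi..0})"
      if t: "t \<in> {-pi..0}" for t
    proof -
      have s: "sin t \<noteq> 1" using sin_nonpos[OF t] by simp
      note d = mu_power_deriv[OF s, of n]
      have ds: "((\<lambda>t. ?K * sin (?K * t)) has_real_derivative ?K * (cos (?K * t) * ?K)) (at t)"
        and dc: "((\<lambda>t. cos (?K * t)) has_real_derivative - sin (?K * t) * ?K) (at t)"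
        by (auto intro!: derivative_eq_intros)
      have "(F has_real_derivative (?K\<^sup>2 * (mu t ^ n * cos (?K * t)) + mu_pow'' n t * cos (?K * t))) (at t)"
        unfolding F_def
        by (rule DERIV_cong[OF DERIV_add[OF DERIV_mult[OF d(1) ds] DERIV_mult[OF d(2) dc]]])
          (simp add: algebra_simps power2_eq_square)
      from has_field_derivative_at_within[OF this] show ?thesis
        by (rule has_real_derivative_iff_has_vector_derivative[THEN iffD1])
    qed
    have h1: "((\<lambda>t. ?K\<^sup>2 * (mu t ^ n * cos (?K * t)) + mu_pow'' n t * cos (?K * t)) has_integral (F 0 - F (-pi))) {-pi..0}"
      by (intro fundamental_theorem_of_calculus dF) auto
    have h2: "((\<lambda>t. ?K\<^sup>2 * (mu t ^ n * cos (?K * t))) has_integral (?K\<^sup>2 * I)) {-pi..0}"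
      unfolding I_def by (intro has_integral_mult_right integrable_integral ci)
    have hi: "((\<lambda>t. mu_pow'' n t * cos (?K * t)) has_integral (F 0 - F (-pi) - ?K\<^sup>2 * I)) {-pi..0}"
      using has_integral_diff[OF h1 h2] by simp
    let ?G = "\<lambda>t. real n * real (n - 1) * (\<bar>mu t\<bar> ^ (n - 2) * hmu t) + real n * (\<bar>mu t\<bar> ^ n * hmu t)"
    have Gi: "?G integrable_on {-pi..0}"
      by (intro integrable_add integrable_on_mult_right chi)
    have "norm (integral {-pi..0} (\<lambda>t. mu_pow'' n t * cos (?K * t))) \<le> integral {-pi..0} ?G"
    proof (rule integral_norm_bound_integral[OF _ Gi])
      show "(\<lambda>t. mu_pow'' n t * cos (?K * t)) integrable_on {-pi..0}" using hi by blast
      fix t assume t: "t \<in> {-pi..0}"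
      have h: "0 \<le> hmu t" "hmu t \<le> 1" using hmu_bounds[of t] t by auto
      have "\<bar>mu_pow'' n t\<bar> \<le> real n * real (n - 1) * (\<bar>mu t\<bar> ^ (n - 2) * (hmu t)\<^sup>2) + real n * (\<bar>mu t\<bar> ^ (n - 1) * \<bar>mu t\<bar> * hmu t)"
        unfolding mu_pow''_def hmu_def[symmetric]
        by (rule order_trans[OF abs_triangle_ineq]) (use h in \<open>simp add: abs_mult power_abs mult.assoc\<close>)
      also have "\<bar>mu t\<bar> ^ (n - 1) * \<bar>mu t\<bar> = \<bar>mu t\<bar> ^ n"
        using n by (simp flip: power_Suc2)
      \<comment> \<open>Lowering \<open>hmu^2\<close> to \<open>hmu\<close> leaves exactly one
        derivative factor for the integral estimate.\<close>
      also have "real n * real (n - 1) * (\<bar>mu t\<bar> ^ (n - 2) * (hmu t)\<^sup>2) + real n * (\<bar>mu t\<bar> ^ n * hmu t) \<le> ?G t"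
        using h mult_left_mono[OF h(2) h(1)]
        by (intro add_mono mult_left_mono) (auto simp: power2_eq_square)
      finally have "\<bar>mu_pow'' n t\<bar> \<le> ?G t" .
      moreover have "\<bar>mu_pow'' n t * cos (?K * t)\<bar> \<le> \<bar>mu_pow'' n t\<bar>"
        by (simp add: abs_mult mult_le_cancel_left2)
      ultimately show "norm (mu_pow'' n t * cos (?K * t)) \<le> ?G t" by simp
    qed
    also have "integral {-pi..0} ?G = real n * real (n - 1) * integral {-pi..0} (\<lambda>t. \<bar>mu t\<bar> ^ (n - 2) * hmu t) +
        real n * integral {-pi..0} (\<lambda>t. \<bar>mu t\<bar> ^ n * hmu t)"
      by (subst Henstock_Kurzweil_Integration.integral_add) (auto intro!: integrable_on_mult_right chi)
    also have "\<dots> \<le> real n * real (n - 1) * (4 / (real (n - 2) + 1)) + real n * (4 / (real n + 1))"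
      by (intro add_mono mult_left_mono integral_abs_mu_power) auto
    also have "\<dots> \<le> 4 * real n + 4 * real n"
    proof (intro add_mono)
      show "real n * real (n - 1) * (4 / (real (n - 2) + 1)) \<le> 4 * real n"
      \<comment> \<open>Only at \<open>n = 1\<close> is \<open>n - 2\<close> truncated, and there
        the factor \<open>n - 1\<close> is zero.\<close>
      proof (cases "n = 1")
        case False
        then have "real (n - 2) + 1 = real (n - 1)" "real (n - 1) > 0" using n by auto
        then show ?thesis by simp
      qed simp
      show "real n * (4 / (real n + 1)) \<le> 4 * real n"
        using n by (simp add: field_simps)
    qed
    finally have "\<bar>F 0 - F (-pi) - ?K\<^sup>2 * I\<bar> \<le> 8 * n"
      using integral_unique[OF hi] by simp
    moreover have "F 0 = n" and "\<bar>F (-pi)\<bar> \<le> n"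
    proof -
      \<comment> \<open>At both ends the sine term vanishes, while \<open>\<bar>mu\<bar> = 1\<close>
        gives \<open>mu_pow'\<close> the modulus \<open>n\<close>. Together the boundary terms cost
        \<open>2 * n\<close>, which raises \<open>8\<close> to \<open>10\<close>.\<close>
      have "sin (?K * (-pi)) = 0" by (simp add: sin_times_pi_eq_0 mult.commute)
      then have "F (-pi) = mu_pow' n (-pi) * cos (?K * (-pi))" by (simp add: F_def)
      moreover have "\<bar>mu_pow' n (-pi)\<bar> = n" by (simp add: mu_pow'_def abs_mult power_abs)
      ultimately show "\<bar>F (-pi)\<bar> \<le> n"
        using abs_cos_le_one[of "k * (-pi)"] by (simp add: abs_mult mult_le_cancel_left2)
      show "F 0 = n" by (simp add: F_def mu_pow'_def)
    qed
    ultimately have "\<bar>?K\<^sup>2 * I\<bar> \<le> 10 * real n" by linarith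
    then show ?thesis by (simp add: abs_mult mult.commute)
  qed simp
qed

lemma nu_power_wiener:
  "(\<lambda>t. of_real (nu t ^ n)) \<in> wiener" "(\<Sum>\<^sub>\<infinity>k. cmod (fourier_coeff (\<lambda>t. of_real (nu t ^ n)) k)) \<le> 100"
proof -
  have "(\<lambda>t. of_real (nu t ^ n)) \<in> wiener \<and> (\<Sum>\<^sub>\<infinity>k. cmod (fourier_coeff (\<lambda>t. of_real (nu t ^ n)) k)) \<le> 100"
  proof (cases "n = 0")
    case True
    have "10 * pi * 1 \<le> 100" using pi_less_4 by simp
    then show ?thesis
      using wiener_of_C2[of "\<lambda>_. 1" "\<lambda>_. 0" "\<lambda>_. 0" 1] True by simp
  next
    case False
    let ?g = "\<lambda>t. complex_of_real (nu t ^ n)"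
    let ?I = "\<lambda>k::int. integral {-pi..0} (\<lambda>t. mu t ^ n * cos (of_int k * t))"
    have coeff: "cmod (fourier_coeff ?g k) = 2 * \<bar>?I k\<bar>" for k
    proof -
      have "fourier_coeff ?g k = of_real (2 * integral {-pi..0} (\<lambda>t. nu t ^ n * cos (of_int k * t)))"
        by (rule fourier_coeff_even) (auto intro!: continuous_intros continuous_on_nu simp: nu_def)
      also have "integral {-pi..0} (\<lambda>t. nu t ^ n * cos (of_int k * t)) = ?I k"
        by (rule integral_cong) (simp add: nu_eq_mu)
      finally show ?thesis by (simp del: of_real_mult)
    qed
    have n: "n \<ge> 1" using False by simp
    \<comment> \<open>The doubled constants \<open>16\<close> and \<open>20\<close> are both covered
      by \<open>20\<close>; the summability criterion turns this into \<open>100\<close>.\<close>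
    have b: "cmod (fourier_coeff ?g k) \<le> 20 / real n" "cmod (fourier_coeff ?g k) * (real_of_int k)\<^sup>2 \<le> 20 * real n" for k
      using integral_mu_power_cos_bounds[OF n, of k] n unfolding coeff by (auto simp: field_simps)
    show ?thesis
      using decay_abs_summable[OF n _ b] by (auto simp: wiener_def intro!: continuous_intros continuous_on_nu)
  qed
  then show "(\<lambda>t. of_real (nu t ^ n)) \<in> wiener" "(\<Sum>\<^sub>\<infinity>k. cmod (fourier_coeff (\<lambda>t. of_real (nu t ^ n)) k)) \<le> 100"
    by auto
qed

section \<open>Smooth test functions\<close>

text \<open>Quantifying over the derivative instead of iterating \<open>vector_derivative\<close>
  lets sums and products be treated by induction on the order.\<close>

primrec times_differentiable :: "nat \<Rightarrow> (real \<Rightarrow> complex) \<Rightarrow> bool" where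
  "times_differentiable 0 f \<longleftrightarrow> True"
| "times_differentiable (Suc k) f \<longleftrightarrow>
     (\<exists>f'. (\<forall>t. (f has_vector_derivative f' t) (at t)) \<and> times_differentiable k f')"

lemma times_differentiable_SucI:
  assumes "\<And>t. (f has_vector_derivative f' t) (at t)" "times_differentiable k f'"
  shows "times_differentiable (Suc k) f"
  using assms by auto

lemma times_differentiable_const: "times_differentiable k (\<lambda>_. c)"
proof (induction k arbitrary: c)
  case (Suc k)
  then show ?case by (auto intro!: exI[of _ "\<lambda>_. 0"])
qed simp

lemma times_differentiable_add:
  "times_differentiable k f \<Longrightarrow> times_differentiable k g \<Longrightarrow> times_differentiable k (\<lambda>t. f t + g t)"
proof (induction k arbitrary: f g)
  case (Suc k)
  then obtain f' g' where "\<forall>t. (f has_vector_derivative f' t) (at t)" "times_differentiable k f'"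
    "\<forall>t. (g has_vector_derivative g' t) (at t)" "times_differentiable k g'" by auto
  then show ?case
    by (auto intro!: exI[of _ "\<lambda>t. f' t + g' t"] has_vector_derivative_add Suc.IH)
qed simp

lemma times_differentiable_Suc_imp: "times_differentiable (Suc k) f \<Longrightarrow> times_differentiable k f"
proof (induction k arbitrary: f)
  case (Suc k)
  from Suc.prems obtain f' where "\<forall>t. (f has_vector_derivative f' t) (at t)" "times_differentiable (Suc k) f'"
    unfolding times_differentiable.simps(2)[of "Suc k"] by blast
  then show ?case using Suc.IH[of f'] by auto
qed simp

lemma times_differentiable_mult:
  "times_differentiable k f \<Longrightarrow> times_differentiable k g \<Longrightarrow> times_differentiable k (\<lambda>t. f t * g t)"
proof (induction k arbitrary: f g)
  case (Suc k)
  \<comment> \<open>The product rule also contains the undifferentiated factors, so they are needed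
    at the lower order.\<close>
  note fg = Suc.prems[THEN times_differentiable_Suc_imp]
  from Suc.prems obtain f' g' where "\<forall>t. (f has_vector_derivative f' t) (at t)" "times_differentiable k f'"
    "\<forall>t. (g has_vector_derivative g' t) (at t)" "times_differentiable k g'" by auto
  then show ?case using fg
    by (auto intro!: exI[of _ "\<lambda>t. f t * g' t + f' t * g t"] has_vector_derivative_mult
        times_differentiable_add Suc.IH)
qed simp

lemma has_vector_derivative_exp_of_int:
  "((\<lambda>t. exp (\<i> * of_int m * of_real t)) has_vector_derivative
     (\<i> * of_int m * exp (\<i> * of_int m * of_real t))) (at t within S)"
  by (rule has_vector_derivative_real_field derivative_eq_intros refl | simp)+

lemma times_differentiable_exp: "times_differentiable k (\<lambda>t. exp (\<i> * of_int m * of_real t))"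
proof (induction k)
  case (Suc k)
  show ?case
    by (rule times_differentiable_SucI[OF has_vector_derivative_exp_of_int])
      (intro times_differentiable_mult times_differentiable_const Suc)
qed simp

lemma times_differentiable_sin_cos:
  "times_differentiable k (\<lambda>t. of_real (sin t)) \<and> times_differentiable k (\<lambda>t. of_real (cos t))"
proof (induction k)
  case (Suc k)
  have s: "((\<lambda>t. of_real (sin t)) has_vector_derivative (of_real (cos t) :: complex)) (at t)" for t
    by (rule has_vector_derivative_of_real_complex) (rule DERIV_sin)
  have c: "((\<lambda>t. of_real (cos t)) has_vector_derivative (-1 * of_real (sin t) :: complex)) (at t)" for t
    using has_vector_derivative_of_real_complex[OF DERIV_cos, of t] by simp
  have "times_differentiable k (\<lambda>t. -1 * of_real (sin t))"
    using Suc by (intro times_differentiable_mult times_differentiable_const) auto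
  then show ?case
    using times_differentiable_SucI[OF s] times_differentiable_SucI[OF c] Suc by blast
qed simp

text \<open>Derivatives are unique, so the iterates of \<open>vector_derivative\<close> agree with
  the witnesses. Differentiability of the \<open>k\<close>-th iterate uses order
  \<open>k + 1\<close>.\<close>

lemma test_function_if_times_differentiable:
  assumes "\<And>k. times_differentiable k \<psi>" and "\<And>t. \<psi> (t + 2 * pi) = \<psi> t"
  shows "\<psi> \<in> torus_test_functions"
proof -
  have "((\<lambda>g s. vector_derivative g (at s)) ^^ k) f differentiable (at t)"
    if "times_differentiable (Suc k) f" for k t f
    using that
  proof (induction k arbitrary: f)
    case 0
    then show ?case by (auto intro: differentiableI_vector)
  next
    case (Suc k)
    from Suc.prems obtain f' where f': "\<forall>t. (f has_vector_derivative f' t) (at t)"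
      and k: "times_differentiable (Suc k) f'"
      unfolding times_differentiable.simps(2)[of "Suc k"] by blast
    have "(\<lambda>s. vector_derivative f (at s)) = f'"
      using f' by (auto simp: vector_derivative_at)
    then show ?case using Suc.IH[OF k] by (simp add: funpow_Suc_right del: funpow.simps)
  qed
  then show ?thesis using assms by (simp add: torus_test_functions_def del: times_differentiable.simps)
qed

section \<open>Flat functions and the bumps built from them\<close>

text \<open>The standard smooth function that is flat at zero, with the powers of
  \<open>1 / x\<close> included so that the family is closed under differentiation.\<close>

definition flat :: "real \<Rightarrow> nat \<Rightarrow> real \<Rightarrow> real" where
  "flat \<epsilon> j x = (if 0 < x then (1 / x) ^ j * exp (- \<epsilon> / x) else 0)"

text \<open>From \<open>(z / m)^m \<le> exp z\<close> with \<open>z = \<epsilon> / x\<close> and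
  \<open>m = j + 2\<close>, the exponential absorbs the pole and leaves \<open>x^2\<close>, enough
  for a zero derivative at the origin.\<close>

lemma flat_le_square:
  assumes "0 < \<epsilon>"
  shows "\<bar>flat \<epsilon> j x\<bar> \<le> (real (j + 2) / \<epsilon>) ^ (j + 2) * x\<^sup>2"
proof (cases "0 < x")
  case True
  let ?m = "j + 2"
  have e: "exp (z / real m) ^ m = exp z" if "0 < m" for z :: real and m :: nat
    using exp_of_nat_mult[of m "z / real m"] that by simp
  have "(\<epsilon> / x / ?m) ^ ?m \<le> exp (\<epsilon> / x / ?m) ^ ?m"
  proof (rule power_mono)
    show "\<epsilon> / x / ?m \<le> exp (\<epsilon> / x / ?m)" using exp_ge_add_one_self[of "\<epsilon> / x / ?m"] by linarith
  qed (use assms True in auto)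
  also have "\<dots> = exp (\<epsilon> / x)"
    using e[of ?m "\<epsilon> / x"] by simp
  finally have le: "(\<epsilon> / x / ?m) ^ ?m \<le> exp (\<epsilon> / x)" .
  have "exp (- \<epsilon> / x) = 1 / exp (\<epsilon> / x)" by (simp add: exp_minus field_simps)
  also have "\<dots> \<le> 1 / (\<epsilon> / x / ?m) ^ ?m"
    by (rule divide_left_mono[OF le]) (use assms True in auto)
  also have "\<dots> = (?m / \<epsilon>) ^ ?m * x ^ ?m"
    using assms True by (simp add: power_divide power_mult_distrib)
  finally have "(1 / x) ^ j * exp (- \<epsilon> / x) \<le> (1 / x) ^ j * ((?m / \<epsilon>) ^ ?m * x ^ ?m)"
    by (rule mult_left_mono) (use True in auto)
  also have "\<dots> = (?m / \<epsilon>) ^ ?m * x\<^sup>2"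
  proof -
    have "(1 / x) ^ j * (C * x ^ ?m) = C * x\<^sup>2" for C
      using True by (simp add: power_add power_one_over power2_eq_square)
    then show ?thesis .
  qed
  finally show ?thesis using True by (simp add: flat_def)
qed (use assms in \<open>simp add: flat_def\<close>)

lemma flat_deriv:
  assumes "0 < \<epsilon>"
  shows "(flat \<epsilon> j has_real_derivative \<epsilon> * flat \<epsilon> (j + 2) x - j * flat \<epsilon> (j + 1) x) (at x)"
proof -
  consider "x < 0" | "x = 0" | "0 < x" by linarith
  then show ?thesis
  proof cases
    case 1
    have "((\<lambda>_. 0) has_real_derivative 0) (at x)" by simp
    then have "(flat \<epsilon> j has_real_derivative 0) (at x)"
      by (rule has_field_derivative_transform_within_open[of _ _ _ "{..<0}"])
         (use 1 in \<open>auto simp: flat_def\<close>)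
    then show ?thesis using 1 by (simp add: flat_def)
  next
    case 2
    let ?C = "(real (j + 2) / \<epsilon>) ^ (j + 2)"
    \<comment> \<open>The quadratic bound makes the difference quotient at zero linear in
      \<open>\<bar>h\<bar>\<close>.\<close>
    have "((\<lambda>h. (flat \<epsilon> j (0 + h) - flat \<epsilon> j 0) / h) \<longlongrightarrow> 0) (at 0)"
    proof (rule Lim_null_comparison)
      show "\<forall>\<^sub>F h in at 0. norm ((flat \<epsilon> j (0 + h) - flat \<epsilon> j 0) / h) \<le> ?C * \<bar>h\<bar>"
        unfolding eventually_at_filter
      proof (intro always_eventually allI impI)
        fix h :: real assume "h \<noteq> 0"
        then show "norm ((flat \<epsilon> j (0 + h) - flat \<epsilon> j 0) / h) \<le> ?C * \<bar>h\<bar>"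
          using flat_le_square[OF assms, of j h]
          by (simp add: flat_def[of _ _ 0] abs_divide divide_le_eq power2_eq_square mult.assoc abs_mult_self_eq)
      qed
      show "((\<lambda>h. ?C * \<bar>h\<bar>) \<longlongrightarrow> 0) (at 0)"
        by (intro tendsto_eq_intros | simp)+
    qed
    then have "(flat \<epsilon> j has_real_derivative 0) (at 0)" by (simp add: DERIV_def)
    then show ?thesis using 2 by (simp add: flat_def)
  next
    case 3
    have "((\<lambda>x. (1 / x) ^ j * exp (- \<epsilon> / x)) has_real_derivative
        \<epsilon> * ((1 / x) ^ (j + 2) * exp (- \<epsilon> / x)) - j * ((1 / x) ^ (j + 1) * exp (- \<epsilon> / x))) (at x)"
    proof -
      have d1: "((\<lambda>x. 1 / x) has_real_derivative - ((1 / x)\<^sup>2)) (at x)"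
        using 3 by (auto intro!: derivative_eq_intros simp: power2_eq_square)
      have d2: "((\<lambda>x. exp (- \<epsilon> / x)) has_real_derivative exp (- \<epsilon> / x) * (\<epsilon> * (1 / x)\<^sup>2)) (at x)"
        using 3 by (auto intro!: derivative_eq_intros simp: power2_eq_square)
      have eq: "(z ^ j * (e * (\<epsilon> * z\<^sup>2))) + (real j * (- (z\<^sup>2) * z ^ (j - Suc 0))) * e =
          \<epsilon> * (z ^ (j + 2) * e) - j * (z ^ (j + 1) * e)" for z e :: real
        by (cases j) (simp_all add: algebra_simps power2_eq_square)
      show ?thesis
        by (rule DERIV_cong[OF DERIV_mult[OF DERIV_power[OF d1] d2]])
          (use eq[of "1 / x" "exp (- \<epsilon> / x)"] in \<open>simp only: mult_ac add_ac\<close>)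
    qed
    then have "(flat \<epsilon> j has_real_derivative
        \<epsilon> * ((1 / x) ^ (j + 2) * exp (- \<epsilon> / x)) - j * ((1 / x) ^ (j + 1) * exp (- \<epsilon> / x))) (at x)"
      by (rule has_field_derivative_transform_within_open[of _ _ _ "{0<..}"])
         (use 3 in \<open>auto simp: flat_def\<close>)
    then show ?thesis using 3 by (simp add: flat_def)
  qed
qed

lemma times_differentiable_flat_sin:
  assumes "0 < \<epsilon>"
  shows "times_differentiable k (\<lambda>t. of_real (flat \<epsilon> j (- sin t - \<epsilon>)))"
proof (induction k arbitrary: j)
  case (Suc k)
  have "((\<lambda>t. flat \<epsilon> j (- sin t - \<epsilon>)) has_real_derivative
      (\<epsilon> * flat \<epsilon> (j + 2) (- sin t - \<epsilon>) - j * flat \<epsilon> (j + 1) (- sin t - \<epsilon>)) * (- cos t)) (at t)" for t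
    by (rule DERIV_chain2[OF flat_deriv[OF assms]]) (rule derivative_eq_intros refl | simp)+
  from has_vector_derivative_of_real_complex[OF this]
  have d: "((\<lambda>t. of_real (flat \<epsilon> j (- sin t - \<epsilon>))) has_vector_derivative
    (of_real \<epsilon> * of_real (flat \<epsilon> (j + 2) (- sin t - \<epsilon>)) +
      (- of_nat j) * of_real (flat \<epsilon> (j + 1) (- sin t - \<epsilon>))) * ((-1) * complex_of_real (cos t))) (at t)" for t
    by (simp add: algebra_simps)
  show ?case
    by (rule times_differentiable_SucI[OF d])
      (intro times_differentiable_mult times_differentiable_add Suc
        times_differentiable_const conjunct2[OF times_differentiable_sin_cos])
qed simp

text \<open>A smooth approximation of the cube of the positive part. The cube compensates the poles
  produced by two derivatives, so these stay bounded uniformly in \<open>\<epsilon>\<close>.\<close>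

definition cubic_bump :: "real \<Rightarrow> real \<Rightarrow> real" where
  "cubic_bump \<epsilon> y = y ^ 3 * flat \<epsilon> 0 y"

definition cubic_bump' :: "real \<Rightarrow> real \<Rightarrow> real" where
  "cubic_bump' \<epsilon> y = 3 * y\<^sup>2 * flat \<epsilon> 0 y + y ^ 3 * (\<epsilon> * flat \<epsilon> 2 y)"

definition cubic_bump'' :: "real \<Rightarrow> real \<Rightarrow> real" where
  "cubic_bump'' \<epsilon> y = 6 * y * flat \<epsilon> 0 y + 6 * y\<^sup>2 * (\<epsilon> * flat \<epsilon> 2 y) +
     y ^ 3 * (\<epsilon> * (\<epsilon> * flat \<epsilon> 4 y - 2 * flat \<epsilon> 3 y))"

lemma cubic_bump_deriv:
  assumes "0 < \<epsilon>"
  shows "(cubic_bump \<epsilon> has_real_derivative cubic_bump' \<epsilon> y) (at y)"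
    and "(cubic_bump' \<epsilon> has_real_derivative cubic_bump'' \<epsilon> y) (at y)"
proof -
  have f0: "(flat \<epsilon> 0 has_real_derivative \<epsilon> * flat \<epsilon> 2 y) (at y)"
    using flat_deriv[OF assms, of 0 y] by (simp add: numeral_2_eq_2)
  have f2: "(flat \<epsilon> 2 has_real_derivative \<epsilon> * flat \<epsilon> 4 y - 2 * flat \<epsilon> 3 y) (at y)"
    using flat_deriv[OF assms, of 2 y] by (simp add: eval_nat_numeral)
  have p3: "((\<lambda>y. y ^ 3) has_real_derivative 3 * y\<^sup>2) (at y)"
    and p2: "((\<lambda>y. 3 * y\<^sup>2) has_real_derivative 6 * y) (at y)"
    by (auto intro!: derivative_eq_intros)
  show "(cubic_bump \<epsilon> has_real_derivative cubic_bump' \<epsilon> y) (at y)"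
    unfolding cubic_bump_def[abs_def] cubic_bump'_def
    by (rule DERIV_cong[OF DERIV_mult[OF p3 f0]]) (simp add: algebra_simps)
  show "(cubic_bump' \<epsilon> has_real_derivative cubic_bump'' \<epsilon> y) (at y)"
    unfolding cubic_bump'_def[abs_def] cubic_bump''_def
    by (rule DERIV_cong[OF DERIV_add[OF DERIV_mult[OF p2 f0] DERIV_mult[OF p3 DERIV_cmult[OF f2]]]])
      (simp add: algebra_simps)
qed

text \<open>With \<open>z = \<epsilon> / y\<close> everything follows from
  \<open>z * exp (- z) \<le> 1\<close> and \<open>1 - exp (- z) \<le> z\<close>. The constants are
  \<open>3 + 1 = 4\<close> and \<open>6 + 4 + 1 = 11\<close>.\<close>

lemma cubic_bump_bounds:
  assumes "0 < \<epsilon>" "\<epsilon> \<le> 1" "y \<le> 1"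
  shows "\<bar>cubic_bump \<epsilon> y\<bar> \<le> 1" "\<bar>cubic_bump' \<epsilon> y\<bar> \<le> 4" "\<bar>cubic_bump'' \<epsilon> y\<bar> \<le> 11"
    "\<bar>cubic_bump \<epsilon> y - max 0 y ^ 3\<bar> \<le> \<epsilon>"
proof -
  have "\<bar>cubic_bump \<epsilon> y\<bar> \<le> 1 \<and> \<bar>cubic_bump' \<epsilon> y\<bar> \<le> 4 \<and> \<bar>cubic_bump'' \<epsilon> y\<bar> \<le> 11 \<and>
    \<bar>cubic_bump \<epsilon> y - max 0 y ^ 3\<bar> \<le> \<epsilon>"
  proof (cases "0 < y")
    case True
    define X where "X = exp (- \<epsilon> / y)"
    have X: "0 < X" "X \<le> 1" using assms True by (auto simp: X_def divide_le_0_iff)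
    have X1: "\<epsilon> / y * X \<le> 1"
    proof -
      have "\<epsilon> / y \<le> exp (\<epsilon> / y)" using exp_ge_add_one_self[of "\<epsilon> / y"] by linarith
      then have "\<epsilon> / y * X \<le> exp (\<epsilon> / y) * X" using X by (intro mult_right_mono) auto
      also have "\<dots> = 1" by (simp add: X_def flip: exp_add)
      finally show ?thesis .
    qed
    have X2: "1 - X \<le> \<epsilon> / y" using exp_ge_add_one_self[of "- \<epsilon> / y"] by (simp add: X_def)
    have b: "cubic_bump \<epsilon> y = y ^ 3 * X" using True by (simp add: cubic_bump_def flat_def X_def)
    have b1: "cubic_bump' \<epsilon> y = (3 * y\<^sup>2 + \<epsilon> * y) * X"
      using True by (simp add: cubic_bump'_def flat_def X_def field_simps power2_eq_square power3_eq_cube)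
    have b2: "cubic_bump'' \<epsilon> y = (6 * y + 4 * \<epsilon>) * X + \<epsilon> * (\<epsilon> / y * X)"
    proof -
      have "flat \<epsilon> 0 y = X" "y\<^sup>2 * flat \<epsilon> 2 y = X" "y ^ 3 * flat \<epsilon> 3 y = X" "y ^ 3 * flat \<epsilon> 4 y = X / y"
        using True by (simp_all add: flat_def X_def power_one_over eval_nat_numeral)
      moreover have "cubic_bump'' \<epsilon> y = 6 * y * flat \<epsilon> 0 y + 6 * \<epsilon> * (y\<^sup>2 * flat \<epsilon> 2 y) +
          \<epsilon> * (\<epsilon> * (y ^ 3 * flat \<epsilon> 4 y) - 2 * (y ^ 3 * flat \<epsilon> 3 y))"
        by (simp add: cubic_bump''_def algebra_simps)
      ultimately show ?thesis by (simp add: algebra_simps)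
    qed
    have y: "y\<^sup>2 \<le> 1" "y ^ 3 \<le> 1" using True assms by (auto intro: power_le_one)
    have "y ^ 3 * X \<le> 1 * 1" using y X True by (intro mult_mono) auto
    then have 1: "\<bar>cubic_bump \<epsilon> y\<bar> \<le> 1" using b True X by simp
    have "\<epsilon> * y \<le> 1 * 1" using assms True by (intro mult_mono) auto
    then have "(3 * y\<^sup>2 + \<epsilon> * y) * X \<le> 4 * 1"
      using y X assms True by (intro mult_mono) auto
    then have 2: "\<bar>cubic_bump' \<epsilon> y\<bar> \<le> 4" using b1 True X assms by simp
    have "(6 * y + 4 * \<epsilon>) * X \<le> 10 * 1" using X assms True by (intro mult_mono) auto
    moreover have "\<epsilon> * (\<epsilon> / y * X) \<le> 1 * 1" using X X1 assms True by (intro mult_mono) auto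
    moreover have "0 \<le> (6 * y + 4 * \<epsilon>) * X" "0 \<le> \<epsilon> * (\<epsilon> / y * X)" using X assms True by auto
    ultimately have 3: "\<bar>cubic_bump'' \<epsilon> y\<bar> \<le> 11" unfolding b2 by linarith
    have "y ^ 3 * (1 - X) \<le> y ^ 3 * (\<epsilon> / y)" using X2 True by (intro mult_left_mono) auto
    also have "\<dots> = y\<^sup>2 * \<epsilon>" using True by (simp add: power2_eq_square power3_eq_cube)
    also have "\<dots> \<le> 1 * \<epsilon>" using y assms by (intro mult_right_mono) auto
    finally have "y ^ 3 * (1 - X) \<le> \<epsilon>" by simp
    moreover have "0 \<le> y ^ 3 * (1 - X)" using X True by simp
    moreover have "cubic_bump \<epsilon> y - max 0 y ^ 3 = - (y ^ 3 * (1 - X))"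
      using True b by (simp add: algebra_simps)
    ultimately have 4: "\<bar>cubic_bump \<epsilon> y - max 0 y ^ 3\<bar> \<le> \<epsilon>" by linarith
    show ?thesis using 1 2 3 4 by blast
  next
    case False
    then show ?thesis using assms
      by (simp add: cubic_bump_def cubic_bump'_def cubic_bump''_def flat_def max_def)
  qed
  then show "\<bar>cubic_bump \<epsilon> y\<bar> \<le> 1" "\<bar>cubic_bump' \<epsilon> y\<bar> \<le> 4" "\<bar>cubic_bump'' \<epsilon> y\<bar> \<le> 11"
    "\<bar>cubic_bump \<epsilon> y - max 0 y ^ 3\<bar> \<le> \<epsilon>" by auto
qed

lemma max_cube_shift_le:
  fixes s \<epsilon> :: real
  assumes "0 < \<epsilon>" "\<epsilon> \<le> 1" "s \<le> 1"
  shows "\<bar>max 0 (s - \<epsilon>) ^ 3 - max 0 s ^ 3\<bar> \<le> 3 * \<epsilon>"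
proof -
  define a b where "a = max 0 (s - \<epsilon>)" and "b = max 0 s"
  have ab: "0 \<le> a" "a \<le> b" "b \<le> 1" "b - a \<le> \<epsilon>" using assms by (auto simp: a_def b_def)
  have "b ^ 3 - a ^ 3 = (b - a) * (b * b + a * b + a * a)"
    by (simp add: algebra_simps power3_eq_cube)
  also have "\<dots> \<le> \<epsilon> * (1 * 1 + 1 * 1 + 1 * 1)"
    using ab by (intro mult_mono add_mono) auto
  finally have "b ^ 3 - a ^ 3 \<le> 3 * \<epsilon>" by simp
  moreover have "a ^ 3 \<le> b ^ 3" using ab by (intro power_mono) auto
  ultimately show ?thesis unfolding a_def b_def by linarith
qed

text \<open>The shift by \<open>\<epsilon>\<close> confines the support to
  \<open>sin t \<le> - \<epsilon>\<close>, away from the ends of the lower arc.\<close>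

abbreviation arc_bump :: "real \<Rightarrow> real \<Rightarrow> complex" where
  "arc_bump \<epsilon> t \<equiv> of_real (cubic_bump \<epsilon> (- sin t - \<epsilon>))"

text \<open>The second derivative in \<open>t\<close> is at most \<open>11 + 4 = 15\<close>, so the
  decay of the coefficients is uniform in \<open>\<epsilon>\<close>.\<close>

lemma arc_bump_C2:
  assumes "0 < \<epsilon>" "\<epsilon> \<le> 1"
  shows "continuous_on {-pi..pi} (arc_bump \<epsilon>)"
    and "cmod (fourier_coeff (arc_bump \<epsilon>) k) * (real_of_int k)\<^sup>2 \<le> 30 * pi"
    and "arc_bump \<epsilon> \<in> wiener"
proof -
  define g1 where "g1 t = cubic_bump' \<epsilon> (- sin t - \<epsilon>) * (- cos t)" for t
  define g2 where "g2 t = cubic_bump'' \<epsilon> (- sin t - \<epsilon>) * (- cos t) * (- cos t) +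
     sin t * cubic_bump' \<epsilon> (- sin t - \<epsilon>)" for t
  have ds: "((\<lambda>t. - sin t - \<epsilon>) has_real_derivative - cos t) (at t)"
    and dc: "((\<lambda>t. - cos t) has_real_derivative sin t) (at t)" for t :: real
    by (auto intro!: derivative_eq_intros)
  have "((\<lambda>t. cubic_bump \<epsilon> (- sin t - \<epsilon>)) has_real_derivative g1 t) (at t)" for t
    unfolding g1_def by (rule DERIV_chain2[OF cubic_bump_deriv(1)[OF assms(1)] ds])
  then have d1: "(arc_bump \<epsilon> has_vector_derivative of_real (g1 t)) (at t within S)" for t S
    by (rule has_vector_derivative_at_within[OF has_vector_derivative_of_real_complex])
  have "(g1 has_real_derivative g2 t) (at t)" for t
    unfolding g1_def[abs_def] g2_def
    by (rule DERIV_mult[OF DERIV_chain2[OF cubic_bump_deriv(2)[OF assms(1)] ds] dc])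
  then have d2: "((\<lambda>t. of_real (g1 t)) has_vector_derivative complex_of_real (g2 t)) (at t within S)" for t S
    by (rule has_vector_derivative_at_within[OF has_vector_derivative_of_real_complex])
  have le1: "- sin t - \<epsilon> \<le> 1" for t
    using sin_ge_minus_one[of t] assms(1) by linarith
  have b: "\<bar>g2 t\<bar> \<le> 15" for t
  proof -
    have "\<bar>g2 t\<bar> \<le> \<bar>cubic_bump'' \<epsilon> (- sin t - \<epsilon>)\<bar> * (\<bar>cos t\<bar> * \<bar>cos t\<bar>) + \<bar>sin t\<bar> * \<bar>cubic_bump' \<epsilon> (- sin t - \<epsilon>)\<bar>"
      unfolding g2_def by (rule order_trans[OF abs_triangle_ineq]) (simp add: abs_mult mult.assoc)
    also have "\<dots> \<le> 11 * (1 * 1) + 1 * 4"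
      by (intro add_mono mult_mono cubic_bump_bounds assms le1 abs_cos_le_one abs_sin_le_one) auto
    finally show ?thesis by simp
  qed
  have bb: "cmod (arc_bump \<epsilon> t) \<le> 15" for t
    using cubic_bump_bounds(1)[OF assms le1, of t] by simp
  have ends: "arc_bump \<epsilon> (- pi) = arc_bump \<epsilon> pi" "complex_of_real (g1 (- pi)) = of_real (g1 pi)"
    by (simp_all add: g1_def)
  show "cmod (fourier_coeff (arc_bump \<epsilon>) k) * (real_of_int k)\<^sup>2 \<le> 30 * pi"
    using fourier_coeff_second_derivative_bound[OF d1 d2 ends, of 15 k] b by simp
  show w: "arc_bump \<epsilon> \<in> wiener"
    using wiener_of_C2(1)[OF d1 d2 ends bb] b by simp
  show "continuous_on {-pi..pi} (arc_bump \<epsilon>)" by (rule wiener_cont[OF w])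
qed

lemma arc_bump_test_function:
  assumes "0 < \<epsilon>"
  shows "(\<lambda>t. exp (\<i> * of_int m * of_real t) * arc_bump \<epsilon> t) \<in> torus_test_functions"
    and "torus_support (\<lambda>t. exp (\<i> * of_int m * of_real t) * arc_bump \<epsilon> t) \<subseteq> {-pi<..<0}"
proof -
  have a: "arc_bump \<epsilon> = (\<lambda>t. let y = (- 1) * of_real (sin t) + (- of_real \<epsilon>) in
      (y * (y * y)) * of_real (flat \<epsilon> 0 (- sin t - \<epsilon>)))"
    by (rule ext) (simp add: cubic_bump_def Let_def power3_eq_cube mult.assoc)
  have td: "times_differentiable k (arc_bump \<epsilon>)" for k
    unfolding a Let_def
    by (intro times_differentiable_mult times_differentiable_add times_differentiable_const
        times_differentiable_flat_sin assms conjunct1[OF times_differentiable_sin_cos])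
  show "(\<lambda>t. exp (\<i> * of_int m * of_real t) * arc_bump \<epsilon> t) \<in> torus_test_functions"
  proof (rule test_function_if_times_differentiable)
    fix t :: real
    have "exp (\<i> * of_int m * complex_of_real (t + 2 * pi)) =
        exp (\<i> * of_int m * complex_of_real t) * exp (2 * of_int m * of_real pi * \<i>)"
      by (simp add: algebra_simps flip: exp_add)
    also have "exp (2 * of_int m * of_real pi * \<i>) = (1 :: complex)"
      using exp_integer_2pi[of "of_int m"] by (simp add: mult_ac)
    finally show "exp (\<i> * of_int m * of_real (t + 2 * pi)) * arc_bump \<epsilon> (t + 2 * pi) =
        exp (\<i> * of_int m * of_real t) * arc_bump \<epsilon> t" by simp
  qed (intro times_differentiable_mult times_differentiable_exp td)
  have "closure {t. exp (\<i> * of_int m * of_real t) * arc_bump \<epsilon> t \<noteq> 0} \<subseteq> {t. sin t \<le> - \<epsilon>}"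
  proof (rule closure_minimal)
    show "closed {t :: real. sin t \<le> - \<epsilon>}" by (intro closed_Collect_le continuous_intros)
    show "{t. exp (\<i> * of_int m * of_real t) * arc_bump \<epsilon> t \<noteq> 0} \<subseteq> {t. sin t \<le> - \<epsilon>}"
      by (auto simp: cubic_bump_def flat_def split: if_splits)
  qed
  moreover have "t \<in> {-pi<..<0}" if "sin t \<le> - \<epsilon>" "t \<in> {-pi..pi}" for t
  proof -
    have "sin t < 0" using that assms by simp
    moreover have "t < 0" using sin_ge_zero[of t] that \<open>sin t < 0\<close> by force
    moreover have "t \<noteq> - pi" using \<open>sin t < 0\<close> by auto
    ultimately show ?thesis using that by auto
  qed
  ultimately show "torus_support (\<lambda>t. exp (\<i> * of_int m * of_real t) * arc_bump \<epsilon> t) \<subseteq> {-pi<..<0}"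
    unfolding torus_support_def by blast
qed

text \<open>Pairing with all modulations of one function therefore gives the whole
  convolution.\<close>

lemma spectral_conv_modulate: "spectral_conv u (\<lambda>t. exp (\<i> * of_int m * of_real t) * g t) 0 = spectral_conv u g m"
proof -
  have "fourier_coeff (\<lambda>t. exp (\<i> * of_int m * of_real t) * g t) k = fourier_coeff g (m + k)" for k
    unfolding fourier_coeff_def by (simp add: algebra_simps exp_add)
  then show ?thesis by (simp add: spectral_conv_def)
qed

section \<open>The cube of the positive part as a limit of test functions\<close>

text \<open>The bumps converge to the cube in the Wiener norm: the coefficients of the difference
  are uniformly small and have uniform quadratic decay, and the summability criterion combines the
  two.\<close>

lemma positive_part_cube_null:
  assumes p: "1 \<le> p" and u: "u \<in> lp p" and supp: "supported_in_upper_arc (fourier_pairing u)"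
  shows "(\<lambda>t. of_real (max 0 (- sin t) ^ 3)) \<in> null_multipliers u"
proof -
  obtain B where B: "\<And>k. cmod (u k) \<le> B" using lp_bounded[OF p u] by blast
  define K :: "real \<Rightarrow> complex" where "K t = of_real (max 0 (- sin t) ^ 3)" for t
  have cK: "continuous_on {-pi..pi} K" unfolding K_def[abs_def] by (intro continuous_intros)
  have zero: "spectral_conv u (arc_bump \<epsilon>) m = 0" if "0 < \<epsilon>" for \<epsilon> m
  proof -
    have "fourier_pairing u (\<lambda>t. exp (\<i> * of_int m * of_real t) * arc_bump \<epsilon> t) = 0"
      using supp arc_bump_test_function[OF that] unfolding supported_in_upper_arc_def by blast
    then show ?thesis by (simp add: fourier_pairing_eq_spectral_conv spectral_conv_modulate)
  qed
  have diff: "cmod (fourier_coeff (\<lambda>t. K t + (- 1) * arc_bump \<epsilon> t) k) \<le> 8 * pi * \<epsilon>"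
    if \<epsilon>: "0 < \<epsilon>" "\<epsilon> \<le> 1" for \<epsilon> k
  proof -
    have "cmod (K t + (- 1) * arc_bump \<epsilon> t) \<le> 4 * \<epsilon>" for t
    proof -
      have s: "- sin t \<le> 1" using sin_ge_minus_one[of t] by linarith
      have "\<bar>cubic_bump \<epsilon> (- sin t - \<epsilon>) - max 0 (- sin t) ^ 3\<bar> \<le> 4 * \<epsilon>"
        using cubic_bump_bounds(4)[OF \<epsilon>, of "- sin t - \<epsilon>"] max_cube_shift_le[OF \<epsilon> s] s \<epsilon> by linarith
      then show ?thesis
        unfolding K_def by (simp add: abs_minus_commute flip: of_real_diff of_real_power)
    qed
    then have "cmod (fourier_coeff (\<lambda>t. K t + (- 1) * arc_bump \<epsilon> t) k) \<le> 2 * pi * (4 * \<epsilon>)"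
      by (intro fourier_coeff_bound continuous_intros cK arc_bump_C2(1)[OF \<epsilon>])
    then show ?thesis by simp
  qed
  have coeff_diff: "fourier_coeff (\<lambda>t. K t + (- 1) * arc_bump \<epsilon> t) k = fourier_coeff K k - fourier_coeff (arc_bump \<epsilon>) k"
    if \<epsilon>: "0 < \<epsilon>" "\<epsilon> \<le> 1" for \<epsilon> k
  proof -
    have "continuous_on {-pi..pi} (\<lambda>t. (- 1) * arc_bump \<epsilon> t)"
      by (intro continuous_intros arc_bump_C2(1)[OF \<epsilon>])
    from fourier_coeff_add[OF cK this] show ?thesis
      using fourier_coeff_cmult[of "-1" "arc_bump \<epsilon>" k] by simp
  qed
  \<comment> \<open>The decay passes from the bumps to their limit.\<close>
  have K2: "cmod (fourier_coeff K k) * (real_of_int k)\<^sup>2 \<le> 30 * pi" for k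
  proof (rule field_le_epsilon)
    fix e :: real assume e: "0 < e"
    let ?c = "8 * pi * (real_of_int k)\<^sup>2"
    \<comment> \<open>Chosen so that \<open>?c * \<epsilon> \<le> e\<close>; the added
      \<open>1\<close> covers \<open>k = 0\<close>, where \<open>?c\<close> is zero.\<close>
    define \<epsilon> where "\<epsilon> = min 1 (e / (?c + 1))"
    have c: "0 \<le> ?c" by simp
    then have c1: "0 < ?c + 1" by linarith
    have \<epsilon>: "0 < \<epsilon>" "\<epsilon> \<le> 1"
      unfolding \<epsilon>_def using divide_pos_pos[OF e c1] by simp_all
    have "?c * \<epsilon> \<le> (?c + 1) * (e / (?c + 1))"
      by (intro mult_mono) (use c c1 \<epsilon> in \<open>auto simp: \<epsilon>_def\<close>)
    also have "\<dots> = e" using c1 by simp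
    finally have ce: "?c * \<epsilon> \<le> e" .
    have "cmod (fourier_coeff K k) \<le> cmod (fourier_coeff (arc_bump \<epsilon>) k) + 8 * pi * \<epsilon>"
      using diff[OF \<epsilon>, of k] norm_triangle_sub[of "fourier_coeff K k" "fourier_coeff (arc_bump \<epsilon>) k"]
      unfolding coeff_diff[OF \<epsilon>] by linarith
    then have "cmod (fourier_coeff K k) * (real_of_int k)\<^sup>2 \<le> (cmod (fourier_coeff (arc_bump \<epsilon>) k) + 8 * pi * \<epsilon>) * (real_of_int k)\<^sup>2"
      by (rule mult_right_mono) simp
    also have "\<dots> = cmod (fourier_coeff (arc_bump \<epsilon>) k) * (real_of_int k)\<^sup>2 + ?c * \<epsilon>"
      by (simp add: algebra_simps)
    also have "\<dots> \<le> 30 * pi + e" using arc_bump_C2(2)[OF \<epsilon>, of k] ce by linarith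
    finally show "cmod (fourier_coeff K k) * (real_of_int k)\<^sup>2 \<le> 30 * pi + e" .
  qed
  \<comment> \<open>For \<open>\<epsilon> = 1 / N^2\<close> the criterion applies with
    \<open>C = 60 * pi / N\<close>: the sup bound is of order \<open>C / N\<close>, and the decay
    constant \<open>30 * pi + 30 * pi\<close> equals \<open>C * N\<close>.\<close>
  have small: "(\<Sum>\<^sub>\<infinity>k. cmod (fourier_coeff (\<lambda>t. K t + (- 1) * arc_bump (1 / (real N)\<^sup>2) t) k)) \<le> 300 * pi / N"
    and wd: "(\<lambda>t. K t + (- 1) * arc_bump (1 / (real N)\<^sup>2) t) \<in> wiener" if N: "1 \<le> N" for N :: nat
  proof -
    let ?\<epsilon> = "1 / (real N)\<^sup>2"
    have \<epsilon>: "0 < ?\<epsilon>" "?\<epsilon> \<le> 1" using N by auto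
    let ?g = "\<lambda>t. K t + (- 1) * arc_bump ?\<epsilon> t"
    have b1: "cmod (fourier_coeff ?g k) \<le> (60 * pi / N) / N" for k
    proof -
      have "8 * pi * ?\<epsilon> \<le> 60 * pi * ?\<epsilon>" by (intro mult_right_mono) auto
      then show ?thesis using diff[OF \<epsilon>, of k] by (simp add: power2_eq_square)
    qed
    have b2: "cmod (fourier_coeff ?g k) * (real_of_int k)\<^sup>2 \<le> (60 * pi / N) * N" for k
    proof -
      have "cmod (fourier_coeff ?g k) * (real_of_int k)\<^sup>2 \<le> (cmod (fourier_coeff K k) + cmod (fourier_coeff (arc_bump ?\<epsilon>) k)) * (real_of_int k)\<^sup>2"
        unfolding coeff_diff[OF \<epsilon>] by (intro mult_right_mono norm_triangle_ineq4) simp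
      also have "\<dots> \<le> 30 * pi + 30 * pi"
        unfolding distrib_right by (intro add_mono K2 arc_bump_C2(2)[OF \<epsilon>])
      finally show ?thesis using N by simp
    qed
    show "(\<Sum>\<^sub>\<infinity>k. cmod (fourier_coeff ?g k)) \<le> 300 * pi / N"
      using decay_abs_summable(2)[OF N _ b1 b2] by simp
    show "?g \<in> wiener"
      using decay_abs_summable(1)[OF N _ b1 b2]
      by (auto simp: wiener_def intro!: continuous_intros cK arc_bump_C2(1)[OF \<epsilon>])
  qed
  have e1: "0 < (1::real)" "(1::real) \<le> 1" by auto
  have wK: "K \<in> wiener"
    by (rule wiener_cong[OF _ wiener_add[OF wd[of 1] arc_bump_C2(3)[OF e1]]]) auto
  have B0: "0 \<le> B" using B[of 0] norm_ge_zero order_trans by blast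
  have "spectral_conv u K m = 0" for m
  proof -
    have le: "cmod (spectral_conv u K m) \<le> B * (300 * pi / N)" if N: "1 \<le> N" for N :: nat
    proof -
      have \<epsilon>: "0 < 1 / (real N)\<^sup>2" "1 / (real N)\<^sup>2 \<le> 1" using N by auto
      have "spectral_conv u (\<lambda>t. K t + (- 1) * arc_bump (1 / (real N)\<^sup>2) t) m = spectral_conv u K m"
        using spectral_conv_add[OF wK wiener_cmult[OF arc_bump_C2(3)[OF \<epsilon>], of "-1"] B, where m = m] zero[OF \<epsilon>(1), of m]
          spectral_conv_cmult[of u "-1" "arc_bump (1 / (real N)\<^sup>2)" m] by simp
      then have "cmod (spectral_conv u K m) \<le> B * (\<Sum>\<^sub>\<infinity>k. cmod (fourier_coeff (\<lambda>t. K t + (- 1) * arc_bump (1 / (real N)\<^sup>2) t) k))"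
        using spectral_conv_bound[OF wd[OF N], of u B m] B by simp
      also have "\<dots> \<le> B * (300 * pi / N)" by (rule mult_left_mono[OF small[OF N] B0])
      finally show ?thesis .
    qed
    have "(\<lambda>N. B * (300 * pi / real N)) \<longlonglongrightarrow> 0"
      by (intro tendsto_mult_right_zero lim_const_over_n)
    then have "cmod (spectral_conv u K m) \<le> 0"
      by (rule LIMSEQ_le_const) (use le in blast)
    then show ?thesis by simp
  qed
  then show ?thesis using wK by (simp add: null_multipliers_def K_def[abs_def])
qed

section \<open>Extension to the half-lattice\<close>

text \<open>The symbol of the residual in the row equation when row \<open>n\<close> has symbol
  \<open>nu^n\<close>.\<close>

definition nu_defect :: "nat \<Rightarrow> real \<Rightarrow> complex" where
  "nu_defect n t = (1 + \<i> * eit t) * of_real (nu t ^ n) - (eit t + \<i>) * of_real (nu t ^ (n + 1))"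

text \<open>On the upper arc \<open>nu\<close> is the exact row multiplier and the defect vanishes.
  On the lower arc \<open>nu = mu\<close>, the factor \<open>(1 - sin t)^(n + 1)\<close> clears the
  denominators, and \<open>(1 - sin t) - (1 + sin t)\<close> leaves
  \<open>- 2 sin t\<close>.\<close>

lemma nu_defect_eq:
  "of_real ((1 - sin t) ^ (n + 1)) * nu_defect n t =
     2 * ((1 + \<i> * eit t) * (of_real (cos t) ^ n * of_real (max 0 (- sin t))))"
proof -
  define c s :: complex where "c = of_real (cos t)" and "s = of_real (sin t)"
  define v :: complex where "v = of_real (nu t)"
  have E: "eit t = c + \<i> * s" by (simp add: c_def s_def complex_eq_iff Re_exp Im_exp)
  have cs: "c * c = 1 - s * s"
  proof -
    have "cos t * cos t = 1 - sin t * sin t" using sin_cos_squared_add3[of t] by linarith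
    then have "complex_of_real (cos t * cos t) = of_real (1 - sin t * sin t)" by (simp only:)
    then show ?thesis by (simp add: c_def s_def)
  qed
  have split: "nu_defect n t = v ^ n * ((1 + \<i> * eit t) - (eit t + \<i>) * v)"
    by (simp add: nu_defect_def v_def algebra_simps)
  \<comment> \<open>The row multiplier \<open>cos t / (1 + sin t)\<close> in a form free of
    division, valid on both arcs.\<close>
  have key: "(1 + \<i> * eit t) * (1 + s) = (eit t + \<i>) * c"
    unfolding E using cs by (simp add: algebra_simps)
  show ?thesis
  proof (cases "sin t \<le> 0")
    case True
    have vc: "(1 - s) * v = c"
    proof -
      have "(1 - sin t) * nu t = cos t" using True by (simp add: nu_def)
      then show ?thesis unfolding v_def c_def s_def by (metis of_real_1 of_real_diff of_real_mult)
    qed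
    have pw: "of_real ((1 - sin t) ^ (n + 1)) = (1 - s) ^ n * (1 - s)"
      by (simp add: s_def)
    have "of_real ((1 - sin t) ^ (n + 1)) * nu_defect n t =
        ((1 - s) * v) ^ n * ((1 - s) * (1 + \<i> * eit t) - (eit t + \<i>) * ((1 - s) * v))"
    proof -
      have "(x ^ n * x) * (v ^ n * (a - b * v)) = (x * v) ^ n * (x * a - b * (x * v))" for x a b
        by (simp add: power_mult_distrib algebra_simps)
      from this[of "1 - s" "1 + \<i> * eit t" "eit t + \<i>"]
      show ?thesis unfolding split pw .
    qed
    also have "\<dots> = c ^ n * ((1 - s) * (1 + \<i> * eit t) - (1 + \<i> * eit t) * (1 + s))"
      unfolding vc key ..
    also have "\<dots> = 2 * ((1 + \<i> * eit t) * (c ^ n * (- s)))" by (simp add: algebra_simps)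
    finally show ?thesis using True by (simp add: c_def s_def max_def)
  next
    case False
    have nz: "1 + s \<noteq> 0"
    proof -
      have "1 + sin t \<noteq> 0" using False by simp
      then show ?thesis unfolding s_def by (metis of_real_1 of_real_add of_real_eq_0_iff)
    qed
    have vc: "(1 + s) * v = c"
    proof -
      have "(1 + sin t) * nu t = cos t" using False by (simp add: nu_def)
      then show ?thesis unfolding v_def c_def s_def by (metis of_real_1 of_real_add of_real_mult)
    qed
    have "(1 + s) * ((1 + \<i> * eit t) - (eit t + \<i>) * v) = (1 + \<i> * eit t) * (1 + s) - (eit t + \<i>) * ((1 + s) * v)"
      by (simp add: algebra_simps)
    also have "\<dots> = 0" unfolding vc key by simp
    finally have "nu_defect n t = 0" using nz by (simp add: split)
    then show ?thesis using False by (simp add: max_def)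
  qed
qed

lemma nu_defect_wiener:
  "nu_defect n \<in> wiener"
proof -
  let ?g = "\<lambda>n t. complex_of_real (nu t ^ n)"
  note w = nu_power_wiener(1)
  show ?thesis
    by (rule wiener_cong[OF _ wiener_add[OF wiener_add[OF w[of n] wiener_cmult[OF wiener_shift[OF w[of n]], of \<i>]]
          wiener_add[OF wiener_cmult[OF wiener_shift[OF w[of "n + 1"]], of "-1"]
            wiener_cmult[OF w[of "n + 1"], of "-\<i>"]]]])
       (simp add: nu_defect_def algebra_simps)
qed

lemma nu_defect_null:
  assumes p: "1 \<le> p" and u: "u \<in> lp p" and supp: "supported_in_upper_arc (fourier_pairing u)"
  shows "nu_defect n \<in> null_multipliers u"
proof -
  let ?K = "\<lambda>t. complex_of_real (max 0 (- sin t) ^ 3)"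
  have c: "(\<lambda>t. of_real (cos t) ^ n * ?K t) \<in> null_multipliers u"
  proof (induction n)
    case 0
    then show ?case using positive_part_cube_null[OF p u supp] by simp
  next
    case (Suc n)
    then show ?case using null_cos[OF p u Suc] by (simp add: mult.assoc)
  qed
  have r: "(\<lambda>t. 2 * ((1 + \<i> * eit t) * (of_real (cos t) ^ n * ?K t))) \<in> null_multipliers u"
    by (rule null_cong[OF _ null_lin[OF p u c null_shift[OF p u c], of 2 "2 * \<i>"]])
       (simp add: algebra_simps)
  let ?h = "\<lambda>t. of_real ((1 - sin t) ^ (n + 1)) * nu_defect n t"
  have wh: "?h \<in> wiener" by (rule wiener_1sin_power[OF nu_defect_wiener])
  \<comment> \<open>The two factors \<open>sin\<close> turn the positive part of
    \<open>- sin t\<close> into its cube, known to annihilate \<open>u\<close>; they are cancelled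
    afterwards, followed by the power of \<open>1 - sin t\<close>.\<close>
  have "(\<lambda>t. of_real (sin t) * (of_real (sin t) * ?h t)) \<in> null_multipliers u"
  proof (rule null_cong[OF _ r])
    fix t :: real
    have "sin t * (sin t * max 0 (- sin t)) = max 0 (- sin t) ^ 3"
      by (simp add: max_def power3_eq_cube)
    then have m: "complex_of_real (sin t) * (of_real (sin t) * of_real (max 0 (- sin t))) = ?K t"
      by (metis of_real_mult)
    have ac: "a * (a * (2 * (x * (y * z)))) = 2 * (x * (y * (a * (a * z))))" for a x y z :: complex
      by (simp add: algebra_simps)
    show "of_real (sin t) * (of_real (sin t) * ?h t) = 2 * ((1 + \<i> * eit t) * (of_real (cos t) ^ n * ?K t))"
      unfolding nu_defect_eq ac m ..
  qed
  then have "?h \<in> null_multipliers u"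
    by (intro null_sin_cancel[OF p u wh] null_sin_cancel[OF p u wiener_sin[OF wh]])
  then show ?thesis by (rule null_1sin_power_cancel[OF p u nu_defect_wiener])
qed

lemma spectral_conv_one:
  "spectral_conv u (\<lambda>_. 1) m = of_real (2 * pi) * u m"
proof -
  have z: "fourier_coeff (\<lambda>_. 1) k = 0" if "k \<noteq> 0" for k
  proof -
    \<comment> \<open>Derivatives of a constant vanish, so the decay estimate holds with bound
      \<open>0\<close>.\<close>
    have "cmod (fourier_coeff (\<lambda>_. 1) k) * (real_of_int k)\<^sup>2 \<le> 2 * pi * 0"
      by (rule fourier_coeff_second_derivative_bound[of _ "\<lambda>_. 0" "\<lambda>_. 0"]) auto
    moreover have "0 < (real_of_int k)\<^sup>2" using that by simp
    ultimately show ?thesis by (simp add: mult_le_0_iff)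
  qed
  have "spectral_conv u (\<lambda>_. 1) m = (\<Sum>\<^sub>\<infinity>k\<in>{m}. u k * fourier_coeff (\<lambda>_. 1) (m - k))"
    unfolding spectral_conv_def by (rule infsum_cong_neutral) (auto simp: z)
  also have "\<dots> = u m * of_real (2 * pi)" by (simp add: fourier_coeff_def scaleR_conv_of_real)
  finally show ?thesis by (simp add: mult.commute)
qed

lemma lp_upper_arc_extends:
  assumes p: "1 \<le> p" and u: "u \<in> lp p" and supp: "supported_in_upper_arc (fourier_pairing u)"
  shows "\<exists>f \<in> Hp p. boundary_restriction f = u"
proof -
  obtain B where B: "\<And>k. cmod (u k) \<le> B" using lp_bounded[OF p u] by blast
  \<comment> \<open>The factor \<open>1 / (2 * pi)\<close> restores the normalisation dropped from
    the coefficients, so that row \<open>0\<close> is \<open>u\<close> itself.\<close>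
  define G where "G n t = of_real (1 / (2 * pi)) * complex_of_real (nu t ^ n)" for n t
  define f where "f m n = spectral_conv u (G n) m" for m n
  have W: "G n \<in> wiener" for n
    unfolding G_def by (rule wiener_cmult[OF nu_power_wiener(1)])
  have S: "(\<Sum>\<^sub>\<infinity>k. cmod (fourier_coeff (G n) k)) \<le> 100" for n
  proof -
    have "(\<Sum>\<^sub>\<infinity>k. cmod (fourier_coeff (G n) k)) =
        1 / (2 * pi) * (\<Sum>\<^sub>\<infinity>k. cmod (fourier_coeff (\<lambda>t. of_real (nu t ^ n)) k))"
      unfolding G_def fourier_coeff_cmult norm_mult norm_of_real by (subst infsum_cmult_right') simp
    also have "\<dots> \<le> 1 * 100"
      by (intro mult_mono nu_power_wiener(2)) (use pi_ge_two in \<open>auto intro!: infsum_nonneg simp: divide_le_eq\<close>)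
    finally show ?thesis by simp
  qed
  have "f m n + \<i> * f (m + 1) n - f (m + 1) (n + 1) - \<i> * f m (n + 1) = 0" for m n
  proof -
    let ?c = "complex_of_real (1 / (2 * pi))"
    note w = W[of n] W[of "n + 1"]
    have "spectral_conv u (\<lambda>t. (G n t + \<i> * (eit t * G n t)) + ((-1) * (eit t * G (n + 1) t) + (-\<i>) * G (n + 1) t)) m =
        (spectral_conv u (G n) m + \<i> * spectral_conv u (G n) (m + 1)) + ((-1) * spectral_conv u (G (n + 1)) (m + 1) + (-\<i>) * spectral_conv u (G (n + 1)) m)"
      by (simp only: spectral_conv_add[OF _ _ B] wiener_add wiener_cmult wiener_shift W spectral_conv_cmult spectral_conv_shift)
    \<comment> \<open>The symbol of the row-equation residual is the defect up to this
      constant.\<close>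
    moreover have "spectral_conv u (\<lambda>t. (G n t + \<i> * (eit t * G n t)) + ((-1) * (eit t * G (n + 1) t) + (-\<i>) * G (n + 1) t)) m =
        spectral_conv u (\<lambda>t. ?c * nu_defect n t) m"
      by (rule spectral_conv_cong) (simp add: G_def nu_defect_def algebra_simps)
    moreover have "spectral_conv u (\<lambda>t. ?c * nu_defect n t) m = 0"
      using nu_defect_null[OF p u supp, of n] by (simp only: spectral_conv_cmult null_multipliers_def mem_Collect_eq mult_zero_right)
    ultimately have "(f m n + \<i> * f (m + 1) n) + ((-1) * f (m + 1) (n + 1) + (-\<i>) * f m (n + 1)) = 0"
      by (simp only: f_def)
    then show ?thesis by (simp only: mult_minus_left mult_1 diff_conv_add_uminus add.assoc)
  qed
  then have hol: "f \<in> Hol" by (simp add: Hol_def)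
  let ?U = "\<Sum>\<^sub>\<infinity>k. cmod (u k) powr p"
  have U0: "0 \<le> ?U" by (intro infsum_nonneg) simp
  have "lp_norm p (\<lambda>m. f m n) \<le> ennreal ((100 powr p * ?U) powr (1 / p))" for n
  proof -
    have "(\<Sum>\<^sub>\<infinity>m. cmod (f m n) powr p) \<le> (\<Sum>\<^sub>\<infinity>k. cmod (fourier_coeff (G n) k)) powr p * ?U"
      unfolding f_def by (rule spectral_conv_lp(2)[OF p W u])
    also have "\<dots> \<le> 100 powr p * ?U"
      by (intro mult_right_mono powr_mono2 S U0 infsum_nonneg) (use p in auto)
    finally have "(\<Sum>\<^sub>\<infinity>m. cmod (f m n) powr p) powr (1 / p) \<le> (100 powr p * ?U) powr (1 / p)"
      by (intro powr_mono2 infsum_nonneg) (use p in auto)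
    then show ?thesis
      using spectral_conv_lp(1)[OF p W u, of n] by (simp add: lp_norm_def f_def ennreal_leI)
  qed
  then have "Hp_norm p f \<le> ennreal ((100 powr p * ?U) powr (1 / p))"
    unfolding Hp_norm_def by (intro SUP_least)
  then have "Hp_norm p f < \<infinity>" by (rule order.strict_trans1) simp
  then have "f \<in> Hp p" using hol by (simp add: Hp_def)
  moreover have "boundary_restriction f = u"
  proof
    fix m
    have "spectral_conv u (G 0) m = of_real (1 / (2 * pi)) * spectral_conv u (\<lambda>_. 1) m"
      using spectral_conv_cmult[of u "of_real (1 / (2 * pi))" "\<lambda>_. 1" m] by (simp add: G_def[abs_def])
    then show "boundary_restriction f m = u m"
      by (simp add: boundary_restriction_def f_def spectral_conv_one)
  qed
  ultimately show ?thesis by blast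
qed

section \<open>Equality of the two spaces\<close>

theorem theorem6p1:
  fixes p :: real
  assumes "1 \<le> p"
  shows "boundary_restriction ` Hp p =
           {f \<in> lp p. supported_in_upper_arc (fourier_pairing f)}"
proof (intro equalityI subsetI)
  fix u assume "u \<in> boundary_restriction ` Hp p"
  then obtain f where f: "f \<in> Hp p" and u: "u = (\<lambda>m. f m 0)"
    by (auto simp: boundary_restriction_def)
  have "lp_norm p u \<le> Hp_norm p f"
    unfolding u Hp_norm_def by (rule SUP_upper) simp
  then have "u \<in> lp p" using f by (auto simp: lp_def Hp_def intro: order.strict_trans1)
  moreover have "supported_in_upper_arc (fourier_pairing u)"
    unfolding supported_in_upper_arc_def fourier_pairing_eq_spectral_conv u
    using Hp_spectrum[OF assms f] by simp
  ultimately show "u \<in> {f \<in> lp p. supported_in_upper_arc (fourier_pairing f)}" by simp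
next
  fix u assume "u \<in> {f \<in> lp p. supported_in_upper_arc (fourier_pairing f)}"
  then show "u \<in> boundary_restriction ` Hp p"
    using lp_upper_arc_extends[OF assms, of u] by auto
qed

end
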